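(* Work in intuitionistic (higher-order) type theory, i.e. the internal logic of an elementary topos, with sets being subsets of a fixed type $U$. Let $\mathcal{X}$ be a family of finite sets such that for every finite set $A$, if every complemented proper subset of $A$ belongs to $\mathcal{X}$, then $A \in \mathcal{X}$. Then every finite set belongs to $\mathcal{X}$. *)

theory Defs
  imports Main
begin

text \<open>
  Isabelle/HOL is classical, so intuitionistic higher-order type theory is represented as an
  object logic: the pure type theory of Lambek and Scott, i.e. the internal language of elementary
  toposes, without a natural numbers type.  The elements of \<^typ>\<open>'g\<close> are the ground types.
\<close>

datatype 'g ty =
    Ground 'g
  | One
  | Om                        \<comment> \<open>truth values; formulas are the terms of this type\<close>
  | Pow "'g ty"
  | Prod "'g ty" "'g ty"

text \<open>
  Variables are de Bruijn indices.  \<open>Compr A \<phi>\<close>, \<open>All A \<phi>\<close> and \<open>Ex A \<phi>\<close> bind index 0 (of type \<open>A\<close>)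
  in \<open>\<phi>\<close>.
\<close>

datatype 'g tm =
    Var nat
  | Star
  | Pair "'g tm" "'g tm"
  | Compr "'g ty" "'g tm"       ("\<^bold>{[_] _\<^bold>}" [0, 0] 1000)
  | Mem "'g tm" "'g tm"         (infix "\<^bold>\<in>" 60)
  | Eq "'g tm" "'g tm"          (infix "\<^bold>=" 60)
  | Top                         ("\<^bold>\<top>")
  | Bot                         ("\<^bold>\<bottom>")
  | And "'g tm" "'g tm"         (infixr "\<^bold>\<and>" 55)
  | Or "'g tm" "'g tm"          (infixr "\<^bold>\<or>" 53)
  | Imp "'g tm" "'g tm"         (infixr "\<^bold>\<longrightarrow>" 52)
  | All "'g ty" "'g tm"         ("(3\<^bold>\<forall>[_]/ _)" [0, 51] 51)
  | Ex "'g ty" "'g tm"          ("(3\<^bold>\<exists>[_]/ _)" [0, 51] 51)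

abbreviation Neg :: "'g tm \<Rightarrow> 'g tm" ("\<^bold>\<not> _" [58] 58) where
  "\<^bold>\<not> \<phi> \<equiv> \<phi> \<^bold>\<longrightarrow> \<^bold>\<bottom>"

abbreviation Iff :: "'g tm \<Rightarrow> 'g tm \<Rightarrow> 'g tm" (infix "\<^bold>\<longleftrightarrow>" 52) where
  "\<phi> \<^bold>\<longleftrightarrow> \<psi> \<equiv> (\<phi> \<^bold>\<longrightarrow> \<psi>) \<^bold>\<and> (\<psi> \<^bold>\<longrightarrow> \<phi>)"


subsection \<open>Renaming and substitution\<close>

definition up_ren :: "(nat \<Rightarrow> nat) \<Rightarrow> nat \<Rightarrow> nat" where
  "up_ren r = case_nat 0 (\<lambda>i. Suc (r i))"

primrec ren :: "(nat \<Rightarrow> nat) \<Rightarrow> 'g tm \<Rightarrow> 'g tm" where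
  "ren r (Var i) = Var (r i)"
| "ren r Star = Star"
| "ren r (Pair a b) = Pair (ren r a) (ren r b)"
| "ren r (\<^bold>{[A] \<phi>\<^bold>}) = \<^bold>{[A] ren (up_ren r) \<phi>\<^bold>}"
| "ren r (a \<^bold>\<in> s) = (ren r a \<^bold>\<in> ren r s)"
| "ren r (a \<^bold>= b) = (ren r a \<^bold>= ren r b)"
| "ren r \<^bold>\<top> = \<^bold>\<top>"
| "ren r \<^bold>\<bottom> = \<^bold>\<bottom>"
| "ren r (\<phi> \<^bold>\<and> \<psi>) = (ren r \<phi> \<^bold>\<and> ren r \<psi>)"
| "ren r (\<phi> \<^bold>\<or> \<psi>) = (ren r \<phi> \<^bold>\<or> ren r \<psi>)"
| "ren r (\<phi> \<^bold>\<longrightarrow> \<psi>) = (ren r \<phi> \<^bold>\<longrightarrow> ren r \<psi>)"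
| "ren r (\<^bold>\<forall>[A] \<phi>) = (\<^bold>\<forall>[A] ren (up_ren r) \<phi>)"
| "ren r (\<^bold>\<exists>[A] \<phi>) = (\<^bold>\<exists>[A] ren (up_ren r) \<phi>)"

abbreviation lift :: "'g tm \<Rightarrow> 'g tm" where
  "lift \<equiv> ren Suc"

definition up_sub :: "(nat \<Rightarrow> 'g tm) \<Rightarrow> nat \<Rightarrow> 'g tm" where
  "up_sub \<sigma> = case_nat (Var 0) (\<lambda>i. lift (\<sigma> i))"

primrec sub :: "(nat \<Rightarrow> 'g tm) \<Rightarrow> 'g tm \<Rightarrow> 'g tm" where
  "sub \<sigma> (Var i) = \<sigma> i"
| "sub \<sigma> Star = Star"
| "sub \<sigma> (Pair a b) = Pair (sub \<sigma> a) (sub \<sigma> b)"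
| "sub \<sigma> (\<^bold>{[A] \<phi>\<^bold>}) = \<^bold>{[A] sub (up_sub \<sigma>) \<phi>\<^bold>}"
| "sub \<sigma> (a \<^bold>\<in> s) = (sub \<sigma> a \<^bold>\<in> sub \<sigma> s)"
| "sub \<sigma> (a \<^bold>= b) = (sub \<sigma> a \<^bold>= sub \<sigma> b)"
| "sub \<sigma> \<^bold>\<top> = \<^bold>\<top>"
| "sub \<sigma> \<^bold>\<bottom> = \<^bold>\<bottom>"
| "sub \<sigma> (\<phi> \<^bold>\<and> \<psi>) = (sub \<sigma> \<phi> \<^bold>\<and> sub \<sigma> \<psi>)"
| "sub \<sigma> (\<phi> \<^bold>\<or> \<psi>) = (sub \<sigma> \<phi> \<^bold>\<or> sub \<sigma> \<psi>)"
| "sub \<sigma> (\<phi> \<^bold>\<longrightarrow> \<psi>) = (sub \<sigma> \<phi> \<^bold>\<longrightarrow> sub \<sigma> \<psi>)"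
| "sub \<sigma> (\<^bold>\<forall>[A] \<phi>) = (\<^bold>\<forall>[A] sub (up_sub \<sigma>) \<phi>)"
| "sub \<sigma> (\<^bold>\<exists>[A] \<phi>) = (\<^bold>\<exists>[A] sub (up_sub \<sigma>) \<phi>)"

text \<open>\<open>inst \<phi> a\<close> is \<open>\<phi>\<close> with index 0 replaced by \<open>a\<close> and the other indices lowered by one.\<close>

definition inst :: "'g tm \<Rightarrow> 'g tm \<Rightarrow> 'g tm" where
  "inst \<phi> a = sub (case_nat a Var) \<phi>"


subsection \<open>Typing\<close>

text \<open>A context is a list of types, the type of index \<open>i\<close> being its \<open>i\<close>-th entry.\<close>

inductive typed :: "'g ty list \<Rightarrow> 'g tm \<Rightarrow> 'g ty \<Rightarrow> bool" ("_ \<tturnstile> _ : _" [50, 50, 50] 50) where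
  "i < length \<Gamma> \<Longrightarrow> \<Gamma> \<tturnstile> Var i : \<Gamma> ! i"
| "\<Gamma> \<tturnstile> Star : One"
| "\<Gamma> \<tturnstile> a : A \<Longrightarrow> \<Gamma> \<tturnstile> b : B \<Longrightarrow> \<Gamma> \<tturnstile> Pair a b : Prod A B"
| "A # \<Gamma> \<tturnstile> \<phi> : Om \<Longrightarrow> \<Gamma> \<tturnstile> \<^bold>{[A] \<phi>\<^bold>} : Pow A"
| "\<Gamma> \<tturnstile> a : A \<Longrightarrow> \<Gamma> \<tturnstile> s : Pow A \<Longrightarrow> \<Gamma> \<tturnstile> (a \<^bold>\<in> s) : Om"
| "\<Gamma> \<tturnstile> a : A \<Longrightarrow> \<Gamma> \<tturnstile> b : A \<Longrightarrow> \<Gamma> \<tturnstile> (a \<^bold>= b) : Om"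
| "\<Gamma> \<tturnstile> \<^bold>\<top> : Om"
| "\<Gamma> \<tturnstile> \<^bold>\<bottom> : Om"
| "\<Gamma> \<tturnstile> \<phi> : Om \<Longrightarrow> \<Gamma> \<tturnstile> \<psi> : Om \<Longrightarrow> \<Gamma> \<tturnstile> (\<phi> \<^bold>\<and> \<psi>) : Om"
| "\<Gamma> \<tturnstile> \<phi> : Om \<Longrightarrow> \<Gamma> \<tturnstile> \<psi> : Om \<Longrightarrow> \<Gamma> \<tturnstile> (\<phi> \<^bold>\<or> \<psi>) : Om"
| "\<Gamma> \<tturnstile> \<phi> : Om \<Longrightarrow> \<Gamma> \<tturnstile> \<psi> : Om \<Longrightarrow> \<Gamma> \<tturnstile> (\<phi> \<^bold>\<longrightarrow> \<psi>) : Om"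
| "A # \<Gamma> \<tturnstile> \<phi> : Om \<Longrightarrow> \<Gamma> \<tturnstile> (\<^bold>\<forall>[A] \<phi>) : Om"
| "A # \<Gamma> \<tturnstile> \<phi> : Om \<Longrightarrow> \<Gamma> \<tturnstile> (\<^bold>\<exists>[A] \<phi>) : Om"


subsection \<open>Intuitionistic entailment\<close>

text \<open>
  \<open>\<Gamma> \<bar> \<Phi> \<turnstile> \<phi>\<close>: the formula \<open>\<phi>\<close> is derivable from the hypotheses \<open>\<Phi>\<close>, all of them in the variable
  context \<open>\<Gamma>\<close>.  The context matters: types may be empty, so a variable may be
  discarded only by the quantifier rules.
\<close>

inductive entails :: "'g ty list \<Rightarrow> 'g tm list \<Rightarrow> 'g tm \<Rightarrow> bool"
    ("_ \<bar> _ \<turnstile> _" [50, 50, 50] 50) where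
  Hyp: "\<forall>\<psi>\<in>set \<Phi>. \<Gamma> \<tturnstile> \<psi> : Om \<Longrightarrow> \<phi> \<in> set \<Phi> \<Longrightarrow> \<Gamma> \<bar> \<Phi> \<turnstile> \<phi>"
| TopI: "\<forall>\<psi>\<in>set \<Phi>. \<Gamma> \<tturnstile> \<psi> : Om \<Longrightarrow> \<Gamma> \<bar> \<Phi> \<turnstile> \<^bold>\<top>"
| BotE: "\<Gamma> \<bar> \<Phi> \<turnstile> \<^bold>\<bottom> \<Longrightarrow> \<Gamma> \<tturnstile> \<phi> : Om \<Longrightarrow> \<Gamma> \<bar> \<Phi> \<turnstile> \<phi>"
| AndI: "\<Gamma> \<bar> \<Phi> \<turnstile> \<phi> \<Longrightarrow> \<Gamma> \<bar> \<Phi> \<turnstile> \<psi> \<Longrightarrow> \<Gamma> \<bar> \<Phi> \<turnstile> (\<phi> \<^bold>\<and> \<psi>)"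
| AndE1: "\<Gamma> \<bar> \<Phi> \<turnstile> (\<phi> \<^bold>\<and> \<psi>) \<Longrightarrow> \<Gamma> \<bar> \<Phi> \<turnstile> \<phi>"
| AndE2: "\<Gamma> \<bar> \<Phi> \<turnstile> (\<phi> \<^bold>\<and> \<psi>) \<Longrightarrow> \<Gamma> \<bar> \<Phi> \<turnstile> \<psi>"
| OrI1: "\<Gamma> \<bar> \<Phi> \<turnstile> \<phi> \<Longrightarrow> \<Gamma> \<tturnstile> \<psi> : Om \<Longrightarrow> \<Gamma> \<bar> \<Phi> \<turnstile> (\<phi> \<^bold>\<or> \<psi>)"
| OrI2: "\<Gamma> \<bar> \<Phi> \<turnstile> \<psi> \<Longrightarrow> \<Gamma> \<tturnstile> \<phi> : Om \<Longrightarrow> \<Gamma> \<bar> \<Phi> \<turnstile> (\<phi> \<^bold>\<or> \<psi>)"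
| OrE: "\<Gamma> \<bar> \<Phi> \<turnstile> (\<phi> \<^bold>\<or> \<psi>) \<Longrightarrow> \<Gamma> \<bar> \<phi> # \<Phi> \<turnstile> \<chi> \<Longrightarrow> \<Gamma> \<bar> \<psi> # \<Phi> \<turnstile> \<chi> \<Longrightarrow> \<Gamma> \<bar> \<Phi> \<turnstile> \<chi>"
| ImpI: "\<Gamma> \<bar> \<phi> # \<Phi> \<turnstile> \<psi> \<Longrightarrow> \<Gamma> \<bar> \<Phi> \<turnstile> (\<phi> \<^bold>\<longrightarrow> \<psi>)"
| ImpE: "\<Gamma> \<bar> \<Phi> \<turnstile> (\<phi> \<^bold>\<longrightarrow> \<psi>) \<Longrightarrow> \<Gamma> \<bar> \<Phi> \<turnstile> \<phi> \<Longrightarrow> \<Gamma> \<bar> \<Phi> \<turnstile> \<psi>"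
| AllI: "A # \<Gamma> \<bar> map lift \<Phi> \<turnstile> \<phi> \<Longrightarrow> \<Gamma> \<bar> \<Phi> \<turnstile> (\<^bold>\<forall>[A] \<phi>)"
| AllE: "\<Gamma> \<bar> \<Phi> \<turnstile> (\<^bold>\<forall>[A] \<phi>) \<Longrightarrow> \<Gamma> \<tturnstile> a : A \<Longrightarrow> \<Gamma> \<bar> \<Phi> \<turnstile> inst \<phi> a"
| ExI: "\<Gamma> \<bar> \<Phi> \<turnstile> inst \<phi> a \<Longrightarrow> \<Gamma> \<tturnstile> a : A \<Longrightarrow> A # \<Gamma> \<tturnstile> \<phi> : Om \<Longrightarrow> \<Gamma> \<bar> \<Phi> \<turnstile> (\<^bold>\<exists>[A] \<phi>)"
| ExE: "\<Gamma> \<bar> \<Phi> \<turnstile> (\<^bold>\<exists>[A] \<phi>) \<Longrightarrow> A # \<Gamma> \<bar> \<phi> # map lift \<Phi> \<turnstile> lift \<psi> \<Longrightarrow> \<Gamma> \<tturnstile> \<psi> : Om \<Longrightarrow> \<Gamma> \<bar> \<Phi> \<turnstile> \<psi>"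
| EqI: "\<forall>\<psi>\<in>set \<Phi>. \<Gamma> \<tturnstile> \<psi> : Om \<Longrightarrow> \<Gamma> \<tturnstile> a : A \<Longrightarrow> \<Gamma> \<bar> \<Phi> \<turnstile> (a \<^bold>= a)"
| EqE: "\<Gamma> \<bar> \<Phi> \<turnstile> (a \<^bold>= b) \<Longrightarrow> \<Gamma> \<bar> \<Phi> \<turnstile> inst \<phi> a \<Longrightarrow> \<Gamma> \<tturnstile> a : A \<Longrightarrow> \<Gamma> \<tturnstile> b : A \<Longrightarrow>
    A # \<Gamma> \<tturnstile> \<phi> : Om \<Longrightarrow> \<Gamma> \<bar> \<Phi> \<turnstile> inst \<phi> b"
| ComprI: "\<Gamma> \<bar> \<Phi> \<turnstile> inst \<phi> a \<Longrightarrow> \<Gamma> \<tturnstile> a : A \<Longrightarrow> A # \<Gamma> \<tturnstile> \<phi> : Om \<Longrightarrow> \<Gamma> \<bar> \<Phi> \<turnstile> (a \<^bold>\<in> \<^bold>{[A] \<phi>\<^bold>})"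
| ComprE: "\<Gamma> \<bar> \<Phi> \<turnstile> (a \<^bold>\<in> \<^bold>{[A] \<phi>\<^bold>}) \<Longrightarrow> \<Gamma> \<bar> \<Phi> \<turnstile> inst \<phi> a"
| SetExt: "\<Gamma> \<bar> \<Phi> \<turnstile> (\<^bold>\<forall>[A] (Var 0 \<^bold>\<in> lift s \<^bold>\<longleftrightarrow> Var 0 \<^bold>\<in> lift t)) \<Longrightarrow> \<Gamma> \<tturnstile> s : Pow A \<Longrightarrow> \<Gamma> \<tturnstile> t : Pow A \<Longrightarrow>
    \<Gamma> \<bar> \<Phi> \<turnstile> (s \<^bold>= t)"
| PropExt: "\<Gamma> \<bar> \<Phi> \<turnstile> (\<phi> \<^bold>\<longleftrightarrow> \<psi>) \<Longrightarrow> \<Gamma> \<bar> \<Phi> \<turnstile> (\<phi> \<^bold>= \<psi>)"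
| One: "\<forall>\<psi>\<in>set \<Phi>. \<Gamma> \<tturnstile> \<psi> : Om \<Longrightarrow> \<Gamma> \<tturnstile> a : One \<Longrightarrow> \<Gamma> \<bar> \<Phi> \<turnstile> (a \<^bold>= Star)"
| PairInj1: "\<Gamma> \<bar> \<Phi> \<turnstile> (Pair a b \<^bold>= Pair c d) \<Longrightarrow> \<Gamma> \<bar> \<Phi> \<turnstile> (a \<^bold>= c)"
| PairInj2: "\<Gamma> \<bar> \<Phi> \<turnstile> (Pair a b \<^bold>= Pair c d) \<Longrightarrow> \<Gamma> \<bar> \<Phi> \<turnstile> (b \<^bold>= d)"
| PairSurj: "\<forall>\<psi>\<in>set \<Phi>. \<Gamma> \<tturnstile> \<psi> : Om \<Longrightarrow> \<Gamma> \<tturnstile> c : Prod A B \<Longrightarrow>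
    \<Gamma> \<bar> \<Phi> \<turnstile> (\<^bold>\<exists>[A] \<^bold>\<exists>[B] (lift (lift c) \<^bold>= Pair (Var 1) (Var 0)))"


subsection \<open>Subsets of a type, and finiteness\<close>

definition empty_tm :: "'g ty \<Rightarrow> 'g tm" where
  "empty_tm U = \<^bold>{[U] \<^bold>\<bottom>\<^bold>}"

definition singleton_tm :: "'g ty \<Rightarrow> 'g tm \<Rightarrow> 'g tm" where
  "singleton_tm U a = \<^bold>{[U] Var 0 \<^bold>= lift a\<^bold>}"

definition union_tm :: "'g ty \<Rightarrow> 'g tm \<Rightarrow> 'g tm \<Rightarrow> 'g tm" where
  "union_tm U s t = \<^bold>{[U] Var 0 \<^bold>\<in> lift s \<^bold>\<or> Var 0 \<^bold>\<in> lift t\<^bold>}"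

definition inter_tm :: "'g ty \<Rightarrow> 'g tm \<Rightarrow> 'g tm \<Rightarrow> 'g tm" where
  "inter_tm U s t = \<^bold>{[U] Var 0 \<^bold>\<in> lift s \<^bold>\<and> Var 0 \<^bold>\<in> lift t\<^bold>}"

definition subset_fm :: "'g ty \<Rightarrow> 'g tm \<Rightarrow> 'g tm \<Rightarrow> 'g tm" where
  "subset_fm U s t = (\<^bold>\<forall>[U] (Var 0 \<^bold>\<in> lift s \<^bold>\<longrightarrow> Var 0 \<^bold>\<in> lift t))"

text \<open>
  The set of (Kuratowski) finite subsets of \<open>U\<close>: those belonging to every family \<open>F\<close> that contains
  the empty set and is closed under \<open>B \<mapsto> B \<union> {x}\<close>.  In the closure condition \<open>x\<close>, \<open>B\<close>, \<open>F\<close> are the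
  indices 0, 1, 2.
\<close>

definition Fin_tm :: "'g ty \<Rightarrow> 'g tm" where
  "Fin_tm U = \<^bold>{[Pow U] \<^bold>\<forall>[Pow (Pow U)]
     ((empty_tm U \<^bold>\<in> Var 0 \<^bold>\<and>
       (\<^bold>\<forall>[Pow U] \<^bold>\<forall>[U] (Var 1 \<^bold>\<in> Var 2 \<^bold>\<longrightarrow> union_tm U (Var 1) (singleton_tm U (Var 0)) \<^bold>\<in> Var 2)))
      \<^bold>\<longrightarrow> Var 1 \<^bold>\<in> Var 0)\<^bold>}"

text \<open>\<open>b\<close> is a subset of \<open>a\<close> that has a complement in the lattice of subsets of \<open>a\<close>.\<close>

definition complemented_subset_fm :: "'g ty \<Rightarrow> 'g tm \<Rightarrow> 'g tm \<Rightarrow> 'g tm" where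
  "complemented_subset_fm U b a =
     (subset_fm U b a \<^bold>\<and>
      (\<^bold>\<exists>[Pow U] (subset_fm U (Var 0) (lift a) \<^bold>\<and>
                 union_tm U (lift b) (Var 0) \<^bold>= lift a \<^bold>\<and>
                 inter_tm U (lift b) (Var 0) \<^bold>= empty_tm U)))"

definition complemented_proper_subset_fm :: "'g ty \<Rightarrow> 'g tm \<Rightarrow> 'g tm \<Rightarrow> 'g tm" where
  "complemented_proper_subset_fm U b a = (complemented_subset_fm U b a \<^bold>\<and> \<^bold>\<not> (b \<^bold>= a))"

text \<open>
  For every finite set \<open>A\<close>, if every complemented proper subset \<open>B\<close> of \<open>A\<close> is in the family \<open>X\<close>,
  then so is \<open>A\<close>.
\<close>

definition progressive_fm :: "'g ty \<Rightarrow> 'g tm \<Rightarrow> 'g tm" where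
  "progressive_fm U X =
     (\<^bold>\<forall>[Pow U] (Var 0 \<^bold>\<in> Fin_tm U \<^bold>\<longrightarrow>
        (\<^bold>\<forall>[Pow U] (complemented_proper_subset_fm U (Var 0) (Var 1) \<^bold>\<longrightarrow> Var 0 \<^bold>\<in> lift (lift X))) \<^bold>\<longrightarrow>
        Var 0 \<^bold>\<in> lift X))"

end

theory Submission
  imports Defs
begin

text \<open>
  Call \<open>a\<close> hereditary if every progressive family contains all complemented subsets of \<open>a\<close>.  Every
  finite set is hereditary, by Kuratowski induction.  Indeed, suppose that \<open>a\<close> is hereditary and \<open>X\<close>
  progressive, and let \<open>E\<close> (\<open>extension_tm\<close> below) be the family of all \<open>b\<close> such that \<open>b \<union> {x} \<in> X\<close>
  if \<open>b\<close> is complemented in \<open>a\<close>.  A complemented subset \<open>c\<close> of \<open>b \<union> {x}\<close> decides whether it contains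
  \<open>x\<close>: if not, it is complemented in \<open>b\<close>; if so, it is \<open>(c \<inter> b) \<union> {x}\<close>, where \<open>c \<inter> b\<close> is
  complemented in \<open>b\<close>, and properly so if \<open>c \<noteq> b \<union> {x}\<close>.  Hence \<open>E\<close> is progressive, and the
  hypothesis on \<open>a\<close>, applied to both \<open>X\<close> and \<open>E\<close>, makes \<open>a \<union> {x}\<close> hereditary.
\<close>

subsection \<open>Renaming and substitution\<close>

lemma up_ren_simps [simp]: "up_ren r 0 = 0" "up_ren r (Suc i) = Suc (r i)"
  by (simp_all add: up_ren_def)

lemma up_sub_simps [simp]: "up_sub \<sigma> 0 = Var 0" "up_sub \<sigma> (Suc i) = lift (\<sigma> i)"
  by (simp_all add: up_sub_def)

lemma up_ren_comp: "up_ren r \<circ> up_ren q = up_ren (r \<circ> q)"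
  by (rule ext) (simp add: up_ren_def split: nat.split)

text \<open>Below a binder the induction meets the renamings extended by \<open>up_ren\<close>, so
  both must vary, and extension must commute with composition. The laws \<open>sub_ren\<close> and
  \<open>ren_sub\<close> follow the same pattern.\<close>

lemma ren_ren: "ren r (ren q t) = ren (r \<circ> q) t"
  by (induction t arbitrary: r q) (simp_all add: up_ren_comp)

lemma ren_lift [simp]: "ren (up_ren r) (lift t) = lift (ren r t)"
  by (simp add: ren_ren comp_def)

lemma up_sub_up_ren: "up_sub \<sigma> \<circ> up_ren r = up_sub (\<sigma> \<circ> r)"
  by (rule ext) (simp add: up_sub_def up_ren_def split: nat.split)

lemma sub_ren: "sub \<sigma> (ren r t) = sub (\<sigma> \<circ> r) t"
  by (induction t arbitrary: \<sigma> r) (simp_all add: up_sub_up_ren)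

lemma ren_up_sub: "ren (up_ren r) \<circ> up_sub \<sigma> = up_sub (ren r \<circ> \<sigma>)"
  by (rule ext) (simp add: up_sub_def split: nat.split)

lemma ren_sub: "ren r (sub \<sigma> t) = sub (ren r \<circ> \<sigma>) t"
  by (induction t arbitrary: \<sigma> r) (simp_all add: ren_up_sub)

lemma sub_up_lift [simp]: "sub (up_sub \<sigma>) (lift t) = lift (sub \<sigma> t)"
  by (simp add: sub_ren ren_sub comp_def)

lemma up_sub_Var: "up_sub Var = Var"
  by (rule ext) (simp add: up_sub_def split: nat.split)

lemma sub_Var: "sub Var t = t"
  by (induction t) (simp_all add: up_sub_Var)

text \<open>A lifted term does not mention index 0, so instantiating index 0 merely undoes the lift.
  Once \<open>inst_def\<close> is unfolded, this rule computes the instances of formulas built from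
  lifted terms.\<close>

lemma sub_inst_lift [simp]: "sub (case_nat a Var) (lift t) = t"
  by (simp add: sub_ren comp_def sub_Var)

text \<open>Both sides are a single substitution, and the two substitutions agree at index 0 and at
  every successor. The cases of \<open>entails_ren\<close> whose rules mention \<open>inst\<close>
  depend on it.\<close>

lemma ren_inst: "ren r (inst \<phi> a) = inst (ren (up_ren r) \<phi>) (ren r a)"
proof -
  have "ren r \<circ> case_nat a Var = case_nat (ren r a) Var \<circ> up_ren r"
    by (rule ext) (simp add: up_ren_def split: nat.split)
  then show ?thesis by (simp add: inst_def ren_sub sub_ren)
qed


subsection \<open>Type inference\<close>

text \<open>Binders carry their types, so a term has at most one type in a given context. Computing
  it turns the typing side conditions of the rules into equations for the simplifier.\<close>

primrec tyof :: "'g tm \<Rightarrow> 'g ty list \<Rightarrow> 'g ty option" where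
  "tyof (Var i) \<Gamma> = (if i < length \<Gamma> then Some (\<Gamma> ! i) else None)"
| "tyof Star \<Gamma> = Some One"
| "tyof (Pair a b) \<Gamma> = (case tyof a \<Gamma> of None \<Rightarrow> None | Some A \<Rightarrow>
     (case tyof b \<Gamma> of None \<Rightarrow> None | Some B \<Rightarrow> Some (Prod A B)))"
| "tyof (\<^bold>{[A] \<phi>\<^bold>}) \<Gamma> = (if tyof \<phi> (A # \<Gamma>) = Some Om then Some (Pow A) else None)"
| "tyof (a \<^bold>\<in> s) \<Gamma> = (case tyof a \<Gamma> of None \<Rightarrow> None | Some A \<Rightarrow>
     (if tyof s \<Gamma> = Some (Pow A) then Some Om else None))"
| "tyof (a \<^bold>= b) \<Gamma> = (case tyof a \<Gamma> of None \<Rightarrow> None | Some A \<Rightarrow>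
     (if tyof b \<Gamma> = Some A then Some Om else None))"
| "tyof \<^bold>\<top> \<Gamma> = Some Om"
| "tyof \<^bold>\<bottom> \<Gamma> = Some Om"
| "tyof (\<phi> \<^bold>\<and> \<psi>) \<Gamma> = (if tyof \<phi> \<Gamma> = Some Om \<and> tyof \<psi> \<Gamma> = Some Om then Some Om else None)"
| "tyof (\<phi> \<^bold>\<or> \<psi>) \<Gamma> = (if tyof \<phi> \<Gamma> = Some Om \<and> tyof \<psi> \<Gamma> = Some Om then Some Om else None)"
| "tyof (\<phi> \<^bold>\<longrightarrow> \<psi>) \<Gamma> = (if tyof \<phi> \<Gamma> = Some Om \<and> tyof \<psi> \<Gamma> = Some Om then Some Om else None)"
| "tyof (\<^bold>\<forall>[A] \<phi>) \<Gamma> = (if tyof \<phi> (A # \<Gamma>) = Some Om then Some Om else None)"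
| "tyof (\<^bold>\<exists>[A] \<phi>) \<Gamma> = (if tyof \<phi> (A # \<Gamma>) = Some Om then Some Om else None)"

lemma tyof_eq_Some: "(tyof t \<Gamma> = Some T) = (\<Gamma> \<tturnstile> t : T)"
proof
  show "tyof t \<Gamma> = Some T \<Longrightarrow> \<Gamma> \<tturnstile> t : T"
    \<comment> \<open>Rules 5 and 6, for membership and equality, have a type in their premises that
      the conclusion does not determine.\<close>
    by (induction t arbitrary: \<Gamma> T)
       (auto split: option.splits if_splits intro: typed.intros
         intro!: typed.intros(5) typed.intros(6))
  show "\<Gamma> \<tturnstile> t : T \<Longrightarrow> tyof t \<Gamma> = Some T"
    by (induction rule: typed.induct) auto
qed

lemma tyof_up_ren:
  assumes "\<And>i. tyof (Var (r i)) \<Delta> = tyof (Var i) \<Gamma>"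
  shows "tyof (Var (up_ren r i)) (A # \<Delta>) = tyof (Var i) (A # \<Gamma>)"
proof (cases i)
  case (Suc j)
  then show ?thesis using assms[of j] by (simp split: if_splits)
qed simp

text \<open>The hypothesis equates options, so an index outside \<open>\<Gamma>\<close> must be sent
  outside \<open>\<Delta>\<close>. This yields an equation that also holds for ill-typed terms and
  can therefore serve as a rewrite rule.\<close>

lemma tyof_ren:
  "(\<And>i. tyof (Var (r i)) \<Delta> = tyof (Var i) \<Gamma>) \<Longrightarrow> tyof (ren r t) \<Delta> = tyof t \<Gamma>"
proof (induction t arbitrary: r \<Gamma> \<Delta>)
  case (Var i)
  then show ?case by simp
next
  case (Compr A \<phi>)
  show ?case using Compr.IH[OF tyof_up_ren[OF Compr.prems]] by simp
next
  case (All A \<phi>)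
  show ?case using All.IH[OF tyof_up_ren[OF All.prems]] by simp
next
  case (Ex A \<phi>)
  show ?case using Ex.IH[OF tyof_up_ren[OF Ex.prems]] by simp
qed (simp_all cong: option.case_cong)

lemma tyof_lift [simp]: "tyof (lift t) (A # \<Gamma>) = tyof t \<Gamma>"
  by (rule tyof_ren) simp

lemma tyof_up_sub:
  assumes "\<And>i. tyof (\<sigma> i) \<Delta> = tyof (Var i) \<Gamma>"
  shows "tyof (up_sub \<sigma> i) (A # \<Delta>) = tyof (Var i) (A # \<Gamma>)"
proof (cases i)
  case (Suc j)
  then show ?thesis using assms[of j] by (simp split: if_splits)
qed simp

lemma tyof_sub:
  "(\<And>i. tyof (\<sigma> i) \<Delta> = tyof (Var i) \<Gamma>) \<Longrightarrow> tyof (sub \<sigma> t) \<Delta> = tyof t \<Gamma>"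
proof (induction t arbitrary: \<sigma> \<Gamma> \<Delta>)
  case (Var i)
  then show ?case by simp
next
  case (Compr A \<phi>)
  show ?case using Compr.IH[OF tyof_up_sub[OF Compr.prems]] by simp
next
  case (All A \<phi>)
  show ?case using All.IH[OF tyof_up_sub[OF All.prems]] by simp
next
  case (Ex A \<phi>)
  show ?case using Ex.IH[OF tyof_up_sub[OF Ex.prems]] by simp
qed (simp_all cong: option.case_cong)

lemma tyof_inst: "tyof a \<Gamma> = Some A \<Longrightarrow> tyof (inst \<phi> a) \<Gamma> = tyof \<phi> (A # \<Gamma>)"
  unfolding inst_def by (rule tyof_sub) (simp split: nat.split)

definition wf_hyps :: "'g ty list \<Rightarrow> 'g tm list \<Rightarrow> bool" where
  "wf_hyps \<Gamma> \<Phi> = (\<forall>\<psi>\<in>set \<Phi>. tyof \<psi> \<Gamma> = Some Om)"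

lemma wf_hyps_simps [simp]:
  "wf_hyps \<Gamma> []"
  "wf_hyps \<Gamma> (\<psi> # \<Phi>) = (tyof \<psi> \<Gamma> = Some Om \<and> wf_hyps \<Gamma> \<Phi>)"
  "wf_hyps (A # \<Gamma>) (map lift \<Phi>) = wf_hyps \<Gamma> \<Phi>"
  by (simp_all add: wf_hyps_def)

text \<open>Lets types be read off derivations: later lemmas can assume derivability and recover
  from it the types of the terms involved. The eliminations that instantiate a formula need
  \<open>tyof_inst\<close>.\<close>

lemma entails_typed: "\<Gamma> \<bar> \<Phi> \<turnstile> \<phi> \<Longrightarrow> wf_hyps \<Gamma> \<Phi> \<and> tyof \<phi> \<Gamma> = Some Om"
proof (induction rule: entails.induct)
  case (AllE \<Gamma> \<Phi> A \<phi> a)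
  then show ?case by (simp add: tyof_inst tyof_eq_Some[symmetric] split: if_splits)
next
  case (EqE \<Gamma> \<Phi> a b \<phi> A)
  then show ?case by (simp add: tyof_inst tyof_eq_Some[symmetric])
next
  case (ComprE \<Gamma> \<Phi> a A \<phi>)
  then show ?case by (auto simp: tyof_inst split: if_splits option.splits)
next
  case (PairSurj \<Phi> \<Gamma> c A B)
  then show ?case by (simp add: wf_hyps_def tyof_eq_Some[symmetric])
qed (auto simp: wf_hyps_def tyof_eq_Some[symmetric] split: if_splits option.splits)

lemmas entails_wf = entails_typed[THEN conjunct1]
lemmas entails_Om = entails_typed[THEN conjunct2]


subsection \<open>Renaming and weakening of derivations\<close>

text \<open>One induction serves both for renaming variables and for adding hypotheses. Asking only
  that \<open>\<Psi>\<close> include the renamed hypotheses lets the induction hypothesis absorb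
  those added by \<open>OrE\<close>, \<open>ImpI\<close> and \<open>ExE\<close>; below a quantifier
  \<open>r\<close> becomes \<open>up_ren r\<close>.\<close>

lemma entails_ren:
  assumes "\<Gamma> \<bar> \<Phi> \<turnstile> \<phi>"
    and "\<And>i. tyof (Var (r i)) \<Delta> = tyof (Var i) \<Gamma>"
    and "ren r ` set \<Phi> \<subseteq> set \<Psi>" and "wf_hyps \<Delta> \<Psi>"
  shows "\<Delta> \<bar> \<Psi> \<turnstile> ren r \<phi>"
  using assms
proof (induction arbitrary: r \<Delta> \<Psi> rule: entails.induct)
  case (Hyp \<Phi> \<Gamma> \<phi>)
  then show ?case by (intro entails.Hyp) (auto simp: wf_hyps_def tyof_eq_Some)
next
  case (TopI \<Phi> \<Gamma>)
  then show ?case by (auto intro!: entails.TopI simp: wf_hyps_def tyof_eq_Some)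
next
  case (BotE \<Gamma> \<Phi> \<phi>)
  note t = tyof_ren[of r \<Delta> \<Gamma>, OF BotE.prems(1)]
  show ?case using BotE.IH[OF BotE.prems] BotE.hyps(2)
    by (auto intro: entails.BotE simp: tyof_eq_Some[symmetric] t)
next
  case (AndI \<Gamma> \<Phi> \<phi> \<psi>)
  show ?case using AndI.IH[OF AndI.prems] by (auto intro: entails.AndI)
next
  case (AndE1 \<Gamma> \<Phi> \<phi> \<psi>)
  show ?case using AndE1.IH[OF AndE1.prems] by (auto intro: entails.AndE1)
next
  case (AndE2 \<Gamma> \<Phi> \<phi> \<psi>)
  show ?case using AndE2.IH[OF AndE2.prems] by (auto intro: entails.AndE2)
next
  case (OrI1 \<Gamma> \<Phi> \<phi> \<psi>)
  note t = tyof_ren[of r \<Delta> \<Gamma>, OF OrI1.prems(1)]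
  show ?case using OrI1.IH[OF OrI1.prems] OrI1.hyps(2)
    by (auto intro: entails.OrI1 simp: tyof_eq_Some[symmetric] t)
next
  case (OrI2 \<Gamma> \<Phi> \<phi> \<psi>)
  note t = tyof_ren[of r \<Delta> \<Gamma>, OF OrI2.prems(1)]
  show ?case using OrI2.IH[OF OrI2.prems] OrI2.hyps(2)
    by (auto intro: entails.OrI2 simp: tyof_eq_Some[symmetric] t)
next
  case (OrE \<Gamma> \<Phi> \<phi> \<psi> \<chi>)
  note t = tyof_ren[of r \<Delta> \<Gamma>, OF OrE.prems(1)]
  \<comment> \<open>The disjuncts become hypotheses, so they must be known to be well typed; their
    types come from the derived disjunction.\<close>
  have "tyof (\<phi> \<^bold>\<or> \<psi>) \<Gamma> = Some Om" using OrE.hyps(1) by (rule entails_Om)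
  then have ty: "tyof (ren r \<phi>) \<Delta> = Some Om" "tyof (ren r \<psi>) \<Delta> = Some Om"
    by (auto simp: t split: if_splits)
  have "\<Delta> \<bar> ren r \<phi> # \<Psi> \<turnstile> ren r \<chi>"
    by (rule OrE.IH(2)[OF OrE.prems(1)]) (use OrE.prems ty in auto)
  moreover have "\<Delta> \<bar> ren r \<psi> # \<Psi> \<turnstile> ren r \<chi>"
    by (rule OrE.IH(3)[OF OrE.prems(1)]) (use OrE.prems ty in auto)
  ultimately show ?case using OrE.IH(1)[OF OrE.prems] by (auto intro: entails.OrE)
next
  case (ImpI \<Gamma> \<phi> \<Phi> \<psi>)
  note t = tyof_ren[of r \<Delta> \<Gamma>, OF ImpI.prems(1)]
  have "tyof \<phi> \<Gamma> = Some Om" using entails_wf[OF ImpI.hyps(1)] by simp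
  then have "\<Delta> \<bar> ren r \<phi> # \<Psi> \<turnstile> ren r \<psi>"
    by (intro ImpI.IH[OF ImpI.prems(1)]) (use ImpI.prems t in auto)
  then show ?case by (auto intro: entails.ImpI)
next
  case (ImpE \<Gamma> \<Phi> \<phi> \<psi>)
  show ?case using ImpE.IH[OF ImpE.prems] by (auto intro: entails.ImpE)
next
  case (AllI A \<Gamma> \<Phi> \<phi>)
  have "A # \<Delta> \<bar> map lift \<Psi> \<turnstile> ren (up_ren r) \<phi>"
    by (rule AllI.IH[OF tyof_up_ren[OF AllI.prems(1)]]) (use AllI.prems in auto)
  then show ?case by (auto intro: entails.AllI)
next
  case (AllE \<Gamma> \<Phi> A \<phi> a)
  note t = tyof_ren[of r \<Delta> \<Gamma>, OF AllE.prems(1)]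
  show ?case using AllE.IH[OF AllE.prems] AllE.hyps(2)
    by (auto intro: entails.AllE simp: tyof_eq_Some[symmetric] t ren_inst)
next
  case (ExI \<Gamma> \<Phi> \<phi> a A)
  note t = tyof_ren[of r \<Delta> \<Gamma>, OF ExI.prems(1)]
  note t' = tyof_ren[of "up_ren r", OF tyof_up_ren[OF ExI.prems(1)]]
  have "\<Delta> \<bar> \<Psi> \<turnstile> inst (ren (up_ren r) \<phi>) (ren r a)"
    using ExI.IH[OF ExI.prems] by (simp add: ren_inst)
  then show ?case using ExI.hyps
    by (auto intro!: entails.ExI simp: tyof_eq_Some[symmetric] t t')
next
  case (ExE \<Gamma> \<Phi> A \<phi> \<psi>)
  note t = tyof_ren[of r \<Delta> \<Gamma>, OF ExE.prems(1)]
  note up = tyof_up_ren[OF ExE.prems(1)]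
  have ty: "tyof \<phi> (A # \<Gamma>) = Some Om" using entails_wf[OF ExE.hyps(2)] by simp
  have "A # \<Delta> \<bar> ren (up_ren r) \<phi> # map lift \<Psi> \<turnstile> ren (up_ren r) (lift \<psi>)"
    by (rule ExE.IH(2)[OF up]) (use ExE.prems ty tyof_ren[of "up_ren r", OF up] in auto)
  then show ?case using ExE.IH(1)[OF ExE.prems] ExE.hyps(3)
    by (auto intro!: entails.ExE[of \<Delta> \<Psi> A "ren (up_ren r) \<phi>"] simp: tyof_eq_Some[symmetric] t)
next
  case (EqI \<Phi> \<Gamma> a A)
  note t = tyof_ren[of r \<Delta> \<Gamma>, OF EqI.prems(1)]
  show ?case using EqI
    by (auto intro!: entails.EqI[where A = A] simp: wf_hyps_def tyof_eq_Some[symmetric] t)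
next
  case (EqE \<Gamma> \<Phi> a b \<phi> A)
  note t = tyof_ren[of r \<Delta> \<Gamma>, OF EqE.prems(1)]
  note t' = tyof_ren[of "up_ren r", OF tyof_up_ren[OF EqE.prems(1)]]
  show ?case unfolding ren_inst
    by (rule entails.EqE[where a = "ren r a" and A = A])
      (use EqE.IH[OF EqE.prems] EqE.hyps in \<open>auto simp: ren_inst tyof_eq_Some[symmetric] t t'\<close>)
next
  case (ComprI \<Gamma> \<Phi> \<phi> a A)
  note t = tyof_ren[of r \<Delta> \<Gamma>, OF ComprI.prems(1)]
  note t' = tyof_ren[of "up_ren r", OF tyof_up_ren[OF ComprI.prems(1)]]
  have "\<Delta> \<bar> \<Psi> \<turnstile> inst (ren (up_ren r) \<phi>) (ren r a)"
    using ComprI.IH[OF ComprI.prems] by (simp add: ren_inst)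
  then show ?case using ComprI.hyps
    by (auto intro!: entails.ComprI simp: tyof_eq_Some[symmetric] t t')
next
  case (ComprE \<Gamma> \<Phi> a A \<phi>)
  show ?case using ComprE.IH[OF ComprE.prems] by (auto intro: entails.ComprE simp: ren_inst)
next
  case (SetExt \<Gamma> \<Phi> A s t)
  note ty = tyof_ren[of r \<Delta> \<Gamma>, OF SetExt.prems(1)]
  show ?case using SetExt.IH[OF SetExt.prems] SetExt.hyps
    by (auto intro!: entails.SetExt[where A = A] simp: tyof_eq_Some[symmetric] ty)
next
  case (PropExt \<Gamma> \<Phi> \<phi> \<psi>)
  show ?case using PropExt.IH[OF PropExt.prems] by (auto intro: entails.PropExt)
next
  case (One \<Phi> \<Gamma> a)
  note t = tyof_ren[of r \<Delta> \<Gamma>, OF One.prems(1)]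
  show ?case using One
    by (auto intro!: entails.One simp: wf_hyps_def tyof_eq_Some[symmetric] t)
next
  case (PairInj1 \<Gamma> \<Phi> a b c d)
  show ?case using PairInj1.IH[OF PairInj1.prems] by (auto intro: entails.PairInj1)
next
  case (PairInj2 \<Gamma> \<Phi> a b c d)
  show ?case using PairInj2.IH[OF PairInj2.prems] by (auto intro: entails.PairInj2)
next
  case (PairSurj \<Phi> \<Gamma> c A B)
  note t = tyof_ren[of r \<Delta> \<Gamma>, OF PairSurj.prems(1)]
  show ?case using PairSurj entails.PairSurj[of \<Psi> \<Delta> "ren r c" A B]
    by (simp add: wf_hyps_def tyof_eq_Some[symmetric] t)
qed

lemma entails_weaken:
  assumes "\<Gamma> \<bar> \<Phi> \<turnstile> \<phi>" "set \<Phi> \<subseteq> set \<Psi>" "wf_hyps \<Gamma> \<Psi>"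
  shows "\<Gamma> \<bar> \<Psi> \<turnstile> \<phi>"
proof -
  have [simp]: "ren (\<lambda>i. i) t = t" for t :: "'g tm"
  proof -
    have "up_ren (\<lambda>i. i) = (\<lambda>i. i)"
      by (rule ext) (simp add: up_ren_def split: nat.split)
    then show ?thesis by (induction t) simp_all
  qed
  show ?thesis using entails_ren[of \<Gamma> \<Phi> \<phi> "\<lambda>i. i" \<Gamma> \<Psi>] assms by simp
qed

lemma entails_lift:
  assumes "\<Gamma> \<bar> \<Phi> \<turnstile> \<phi>"
  shows "A # \<Gamma> \<bar> map lift \<Phi> \<turnstile> lift \<phi>"
  using assms by (rule entails_ren) (use entails_wf[OF assms] in auto)

lemma entails_cons:
  assumes "\<Gamma> \<bar> \<Phi> \<turnstile> \<phi>" "tyof \<psi> \<Gamma> = Some Om"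
  shows "\<Gamma> \<bar> \<psi> # \<Phi> \<turnstile> \<phi>"
  using assms(1) by (rule entails_weaken) (use entails_wf[OF assms(1)] assms(2) in auto)

text \<open>The usual transport of an outer fact into a subproof that has opened one variable and
  assumed one formula about it.\<close>

lemma entails_lift_cons:
  assumes "\<Gamma> \<bar> \<Phi> \<turnstile> \<phi>" "tyof \<psi> (A # \<Gamma>) = Some Om"
  shows "A # \<Gamma> \<bar> \<psi> # map lift \<Phi> \<turnstile> lift \<phi>"
  by (rule entails_cons[OF entails_lift[OF assms(1)] assms(2)])

lemma entails_hyp:
  "wf_hyps \<Gamma> \<Phi> \<Longrightarrow> \<phi> \<in> set \<Phi> \<Longrightarrow> \<Gamma> \<bar> \<Phi> \<turnstile> \<phi>"
  by (rule Hyp) (auto simp: wf_hyps_def tyof_eq_Some)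

section \<open>Derived rules: computed typing, discharged hypotheses, equality\<close>

lemmas OrI1_tyof = OrI1[folded tyof_eq_Some]
lemmas OrI2_tyof = OrI2[folded tyof_eq_Some]
lemmas BotE_tyof = BotE[folded tyof_eq_Some]
lemmas AllE_tyof = AllE[folded tyof_eq_Some]
lemmas ExI_tyof = ExI[folded tyof_eq_Some]
lemmas ExE_tyof = ExE[folded tyof_eq_Some]
lemmas EqE_tyof = EqE[folded tyof_eq_Some]
lemmas ComprI_tyof = ComprI[folded tyof_eq_Some]
lemmas SetExt_tyof = SetExt[folded tyof_eq_Some]

lemma EqI_tyof: "wf_hyps \<Gamma> \<Phi> \<Longrightarrow> tyof a \<Gamma> = Some A \<Longrightarrow> \<Gamma> \<bar> \<Phi> \<turnstile> (a \<^bold>= a)"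
  by (rule EqI) (auto simp: wf_hyps_def tyof_eq_Some)

text \<open>For structured proofs: the discharged formula is handed over as a derivation from the
  extended hypotheses, ready for forward rules. \<open>OrE_hyp\<close> does the same for both cases
  of a disjunction.\<close>

lemma ImpI_hyp:
  assumes "wf_hyps \<Gamma> \<Phi>" "tyof \<phi> \<Gamma> = Some Om"
    and "\<Gamma> \<bar> \<phi> # \<Phi> \<turnstile> \<phi> \<Longrightarrow> \<Gamma> \<bar> \<phi> # \<Phi> \<turnstile> \<psi>"
  shows "\<Gamma> \<bar> \<Phi> \<turnstile> (\<phi> \<^bold>\<longrightarrow> \<psi>)"
  by (rule ImpI, rule assms(3), rule entails_hyp) (use assms in auto)

lemma OrE_hyp:
  assumes "\<Gamma> \<bar> \<Phi> \<turnstile> (\<phi> \<^bold>\<or> \<psi>)"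
    and "\<Gamma> \<bar> \<phi> # \<Phi> \<turnstile> \<phi> \<Longrightarrow> \<Gamma> \<bar> \<phi> # \<Phi> \<turnstile> \<chi>"
    and "\<Gamma> \<bar> \<psi> # \<Phi> \<turnstile> \<psi> \<Longrightarrow> \<Gamma> \<bar> \<psi> # \<Phi> \<turnstile> \<chi>"
  shows "\<Gamma> \<bar> \<Phi> \<turnstile> \<chi>"
proof (rule OrE[OF assms(1)])
  have "wf_hyps \<Gamma> (\<phi> # \<Phi>)" "wf_hyps \<Gamma> (\<psi> # \<Phi>)"
    using entails_typed[OF assms(1)] by (auto split: if_splits)
  then show "\<Gamma> \<bar> \<phi> # \<Phi> \<turnstile> \<chi>" "\<Gamma> \<bar> \<psi> # \<Phi> \<turnstile> \<chi>"
    using assms(2,3) by (simp_all add: entails_hyp)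
qed

lemma eq_sym:
  assumes "\<Gamma> \<bar> \<Phi> \<turnstile> (a \<^bold>= b)"
  shows "\<Gamma> \<bar> \<Phi> \<turnstile> (b \<^bold>= a)"
proof -
  obtain A where A: "tyof a \<Gamma> = Some A" "tyof b \<Gamma> = Some A"
    using entails_Om[OF assms] by (auto split: option.splits if_splits)
  show ?thesis
    \<comment> \<open>Leibniz's rule for the formula \<open>z = a\<close> in the variable
      \<open>z\<close>: at \<open>a\<close> it is reflexivity, at \<open>b\<close> it is the
      goal.\<close>
    using EqE_tyof[OF assms, where \<phi> = "Var 0 \<^bold>= lift a" and A = A]
      EqI_tyof[OF entails_wf[OF assms] A(1)] A
    by (simp add: inst_def)
qed

lemma eq_mem_left:
  assumes "\<Gamma> \<bar> \<Phi> \<turnstile> (a \<^bold>= b)" "\<Gamma> \<bar> \<Phi> \<turnstile> (a \<^bold>\<in> s)"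
  shows "\<Gamma> \<bar> \<Phi> \<turnstile> (b \<^bold>\<in> s)"
proof -
  obtain A where "tyof a \<Gamma> = Some A" "tyof b \<Gamma> = Some A" "tyof s \<Gamma> = Some (Pow A)"
    using entails_Om[OF assms(1)] entails_Om[OF assms(2)]
    by (auto split: option.splits if_splits)
  then show ?thesis
    using EqE_tyof[OF assms(1), where \<phi> = "Var 0 \<^bold>\<in> lift s" and A = A] assms(2)
    by (simp add: inst_def)
qed

lemma eq_mem_right:
  assumes "\<Gamma> \<bar> \<Phi> \<turnstile> (s \<^bold>= t)" "\<Gamma> \<bar> \<Phi> \<turnstile> (a \<^bold>\<in> s)"
  shows "\<Gamma> \<bar> \<Phi> \<turnstile> (a \<^bold>\<in> t)"
proof -
  obtain A where "tyof a \<Gamma> = Some A" "tyof s \<Gamma> = Some (Pow A)" "tyof t \<Gamma> = Some (Pow A)"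
    using entails_Om[OF assms(1)] entails_Om[OF assms(2)]
    by (auto split: option.splits if_splits)
  then show ?thesis
    using EqE_tyof[OF assms(1), where \<phi> = "lift a \<^bold>\<in> Var 0" and A = "Pow A"] assms(2)
    by (simp add: inst_def)
qed

lemma set_eqI:
  assumes "U # \<Gamma> \<bar> (Var 0 \<^bold>\<in> lift s) # map lift \<Phi> \<turnstile> (Var 0 \<^bold>\<in> lift t)"
    and "U # \<Gamma> \<bar> (Var 0 \<^bold>\<in> lift t) # map lift \<Phi> \<turnstile> (Var 0 \<^bold>\<in> lift s)"
  shows "\<Gamma> \<bar> \<Phi> \<turnstile> (s \<^bold>= t)"
proof (rule SetExt_tyof)
  show "\<Gamma> \<bar> \<Phi> \<turnstile> (\<^bold>\<forall>[U] (Var 0 \<^bold>\<in> lift s \<^bold>\<longleftrightarrow> Var 0 \<^bold>\<in> lift t))"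
    using assms by (intro AllI AndI ImpI)
qed (use entails_Om[OF assms(1)] entails_Om[OF assms(2)] in \<open>auto split: if_splits\<close>)

lemma compr_iff:
  assumes "tyof a \<Gamma> = Some A" "tyof \<phi> (A # \<Gamma>) = Some Om"
  shows "(\<Gamma> \<bar> \<Phi> \<turnstile> (a \<^bold>\<in> \<^bold>{[A] \<phi>\<^bold>})) = (\<Gamma> \<bar> \<Phi> \<turnstile> inst \<phi> a)"
  using ComprI_tyof[OF _ assms] ComprE by blast


subsection \<open>Operations on subsets\<close>

definition insert_tm :: "'g ty \<Rightarrow> 'g tm \<Rightarrow> 'g tm \<Rightarrow> 'g tm" where
  "insert_tm U s x = union_tm U s (singleton_tm U x)"

text \<open>These rules and their analogues for \<open>sub\<close> and \<open>tyof\<close> allow the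
  set operations to stay folded: renaming, substitution and typing act directly on the
  arguments.\<close>

lemma ren_set_ops [simp]:
  "ren r (empty_tm U) = empty_tm U"
  "ren r (union_tm U s t) = union_tm U (ren r s) (ren r t)"
  "ren r (inter_tm U s t) = inter_tm U (ren r s) (ren r t)"
  "ren r (insert_tm U s x) = insert_tm U (ren r s) (ren r x)"
  "ren r (subset_fm U s t) = subset_fm U (ren r s) (ren r t)"
  "ren r (complemented_subset_fm U s t) = complemented_subset_fm U (ren r s) (ren r t)"
  "ren r (complemented_proper_subset_fm U s t) = complemented_proper_subset_fm U (ren r s) (ren r t)"
  by (simp_all add: empty_tm_def union_tm_def inter_tm_def singleton_tm_def insert_tm_def
      subset_fm_def complemented_subset_fm_def complemented_proper_subset_fm_def)

lemma sub_set_ops [simp]: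
  "sub \<sigma> (empty_tm U) = empty_tm U"
  "sub \<sigma> (union_tm U s t) = union_tm U (sub \<sigma> s) (sub \<sigma> t)"
  "sub \<sigma> (inter_tm U s t) = inter_tm U (sub \<sigma> s) (sub \<sigma> t)"
  "sub \<sigma> (insert_tm U s x) = insert_tm U (sub \<sigma> s) (sub \<sigma> x)"
  "sub \<sigma> (subset_fm U s t) = subset_fm U (sub \<sigma> s) (sub \<sigma> t)"
  "sub \<sigma> (complemented_subset_fm U s t) = complemented_subset_fm U (sub \<sigma> s) (sub \<sigma> t)"
  "sub \<sigma> (complemented_proper_subset_fm U s t) = complemented_proper_subset_fm U (sub \<sigma> s) (sub \<sigma> t)"
  by (simp_all add: empty_tm_def union_tm_def inter_tm_def singleton_tm_def insert_tm_def
      subset_fm_def complemented_subset_fm_def complemented_proper_subset_fm_def)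

lemma tyof_set_ops [simp]:
  "tyof (empty_tm U) \<Gamma> = Some (Pow U)"
  "tyof (union_tm U s t) \<Gamma> =
     (if tyof s \<Gamma> = Some (Pow U) \<and> tyof t \<Gamma> = Some (Pow U) then Some (Pow U) else None)"
  "tyof (inter_tm U s t) \<Gamma> =
     (if tyof s \<Gamma> = Some (Pow U) \<and> tyof t \<Gamma> = Some (Pow U) then Some (Pow U) else None)"
  "tyof (insert_tm U s x) \<Gamma> =
     (if tyof s \<Gamma> = Some (Pow U) \<and> tyof x \<Gamma> = Some U then Some (Pow U) else None)"
  "tyof (subset_fm U s t) \<Gamma> =
     (if tyof s \<Gamma> = Some (Pow U) \<and> tyof t \<Gamma> = Some (Pow U) then Some Om else None)"
  "tyof (complemented_subset_fm U s t) \<Gamma> =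
     (if tyof s \<Gamma> = Some (Pow U) \<and> tyof t \<Gamma> = Some (Pow U) then Some Om else None)"
  "tyof (complemented_proper_subset_fm U s t) \<Gamma> =
     (if tyof s \<Gamma> = Some (Pow U) \<and> tyof t \<Gamma> = Some (Pow U) then Some Om else None)"
  by (auto simp: empty_tm_def union_tm_def inter_tm_def singleton_tm_def insert_tm_def
      subset_fm_def complemented_subset_fm_def complemented_proper_subset_fm_def)

section \<open>Membership rules for the set operations\<close>

lemma mem_typedD:
  assumes "\<Gamma> \<bar> \<Phi> \<turnstile> (y \<^bold>\<in> s)" "tyof s \<Gamma> = Some (Pow U)"
  shows "tyof y \<Gamma> = Some U"
  using entails_Om[OF assms(1)] assms(2) by (auto split: option.splits if_splits)

lemma mem_empty_D: "\<Gamma> \<bar> \<Phi> \<turnstile> (y \<^bold>\<in> empty_tm U) \<Longrightarrow> \<Gamma> \<bar> \<Phi> \<turnstile> \<^bold>\<bottom>"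
  unfolding empty_tm_def by (drule ComprE) (simp add: inst_def)

lemma mem_union_I1:
  assumes "\<Gamma> \<bar> \<Phi> \<turnstile> (y \<^bold>\<in> s)" "tyof s \<Gamma> = Some (Pow U)" "tyof t \<Gamma> = Some (Pow U)"
  shows "\<Gamma> \<bar> \<Phi> \<turnstile> (y \<^bold>\<in> union_tm U s t)"
proof -
  have "tyof y \<Gamma> = Some U" using assms(1,2) by (rule mem_typedD)
  then show ?thesis unfolding union_tm_def
    using assms by (subst compr_iff) (auto simp: inst_def intro: OrI1_tyof)
qed

lemma mem_union_I2:
  assumes "\<Gamma> \<bar> \<Phi> \<turnstile> (y \<^bold>\<in> t)" "tyof s \<Gamma> = Some (Pow U)" "tyof t \<Gamma> = Some (Pow U)"
  shows "\<Gamma> \<bar> \<Phi> \<turnstile> (y \<^bold>\<in> union_tm U s t)"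
proof -
  have "tyof y \<Gamma> = Some U" using assms(1,3) by (rule mem_typedD)
  then show ?thesis unfolding union_tm_def
    using assms by (subst compr_iff) (auto simp: inst_def intro: OrI2_tyof)
qed

lemma mem_union_D:
  "\<Gamma> \<bar> \<Phi> \<turnstile> (y \<^bold>\<in> union_tm U s t) \<Longrightarrow> \<Gamma> \<bar> \<Phi> \<turnstile> (y \<^bold>\<in> s \<^bold>\<or> y \<^bold>\<in> t)"
  unfolding union_tm_def by (drule ComprE) (simp add: inst_def)

lemma mem_inter_I:
  assumes "\<Gamma> \<bar> \<Phi> \<turnstile> (y \<^bold>\<in> s)" "\<Gamma> \<bar> \<Phi> \<turnstile> (y \<^bold>\<in> t)" "tyof s \<Gamma> = Some (Pow U)"
  shows "\<Gamma> \<bar> \<Phi> \<turnstile> (y \<^bold>\<in> inter_tm U s t)"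
proof -
  have y: "tyof y \<Gamma> = Some U" using assms(1,3) by (rule mem_typedD)
  then have "tyof t \<Gamma> = Some (Pow U)"
    using entails_Om[OF assms(2)] by (auto split: if_splits)
  with y show ?thesis unfolding inter_tm_def
    using assms by (subst compr_iff) (auto simp: inst_def intro: AndI)
qed

lemma mem_inter_D:
  assumes "\<Gamma> \<bar> \<Phi> \<turnstile> (y \<^bold>\<in> inter_tm U s t)"
  shows "\<Gamma> \<bar> \<Phi> \<turnstile> (y \<^bold>\<in> s)" "\<Gamma> \<bar> \<Phi> \<turnstile> (y \<^bold>\<in> t)"
proof -
  have "\<Gamma> \<bar> \<Phi> \<turnstile> (y \<^bold>\<in> s \<^bold>\<and> y \<^bold>\<in> t)"
    using assms unfolding inter_tm_def by (drule_tac ComprE) (simp add: inst_def)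
  then show "\<Gamma> \<bar> \<Phi> \<turnstile> (y \<^bold>\<in> s)" "\<Gamma> \<bar> \<Phi> \<turnstile> (y \<^bold>\<in> t)"
    by (rule AndE1, rule AndE2)
qed

lemma mem_insert_I1:
  assumes "\<Gamma> \<bar> \<Phi> \<turnstile> (y \<^bold>\<in> s)" "tyof s \<Gamma> = Some (Pow U)" "tyof x \<Gamma> = Some U"
  shows "\<Gamma> \<bar> \<Phi> \<turnstile> (y \<^bold>\<in> insert_tm U s x)"
  unfolding insert_tm_def
  by (rule mem_union_I1[OF assms(1,2)]) (use assms(3) in \<open>simp add: singleton_tm_def\<close>)

lemma mem_insert_I2:
  assumes "\<Gamma> \<bar> \<Phi> \<turnstile> (y \<^bold>= x)" "tyof s \<Gamma> = Some (Pow U)" "tyof x \<Gamma> = Some U"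
  shows "\<Gamma> \<bar> \<Phi> \<turnstile> (y \<^bold>\<in> insert_tm U s x)"
  unfolding insert_tm_def
proof (rule mem_union_I2)
  have "tyof y \<Gamma> = Some U"
    using entails_Om[OF assms(1)] assms(3) by (auto split: option.splits if_splits)
  then show "\<Gamma> \<bar> \<Phi> \<turnstile> (y \<^bold>\<in> singleton_tm U x)"
    unfolding singleton_tm_def using assms by (subst compr_iff) (auto simp: inst_def)
qed (use assms in \<open>auto simp: singleton_tm_def\<close>)

lemma mem_insert_D:
  assumes "\<Gamma> \<bar> \<Phi> \<turnstile> (y \<^bold>\<in> insert_tm U s x)"
  shows "\<Gamma> \<bar> \<Phi> \<turnstile> (y \<^bold>\<in> s \<^bold>\<or> y \<^bold>= x)"
proof (rule OrE_hyp[OF mem_union_D[OF assms[unfolded insert_tm_def]]])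
  have "tyof (y \<^bold>\<in> insert_tm U s x) \<Gamma> = Some Om" using assms by (rule entails_Om)
  then have ty: "tyof y \<Gamma> = Some U" "tyof s \<Gamma> = Some (Pow U)" "tyof x \<Gamma> = Some U"
    by (auto split: option.splits if_splits)
  show "\<Gamma> \<bar> (y \<^bold>\<in> s) # \<Phi> \<turnstile> (y \<^bold>\<in> s \<^bold>\<or> y \<^bold>= x)" if "\<Gamma> \<bar> (y \<^bold>\<in> s) # \<Phi> \<turnstile> (y \<^bold>\<in> s)"
    using that by (rule OrI1_tyof) (simp add: ty)
  let ?S = "y \<^bold>\<in> singleton_tm U x"
  show "\<Gamma> \<bar> ?S # \<Phi> \<turnstile> (y \<^bold>\<in> s \<^bold>\<or> y \<^bold>= x)" if "\<Gamma> \<bar> ?S # \<Phi> \<turnstile> ?S"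
  proof (rule OrI2_tyof)
    show "\<Gamma> \<bar> ?S # \<Phi> \<turnstile> (y \<^bold>= x)"
      using ComprE[OF that[unfolded singleton_tm_def]]
      by (simp add: inst_def singleton_tm_def)
  qed (simp add: ty)
qed

lemma subset_D:
  assumes "\<Gamma> \<bar> \<Phi> \<turnstile> subset_fm U s t" "\<Gamma> \<bar> \<Phi> \<turnstile> (y \<^bold>\<in> s)"
  shows "\<Gamma> \<bar> \<Phi> \<turnstile> (y \<^bold>\<in> t)"
proof -
  have "tyof s \<Gamma> = Some (Pow U)" using entails_Om[OF assms(1)] by (simp split: if_splits)
  with assms(2) have "tyof y \<Gamma> = Some U" by (rule mem_typedD)
  from AllE_tyof[OF assms(1)[unfolded subset_fm_def] this] show ?thesis
    using assms(2) by (simp add: inst_def ImpE)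
qed


subsection \<open>Complemented subsets\<close>

lemma complemented_subset_D:
  "\<Gamma> \<bar> \<Phi> \<turnstile> complemented_subset_fm U b a \<Longrightarrow> \<Gamma> \<bar> \<Phi> \<turnstile> (y \<^bold>\<in> b) \<Longrightarrow> \<Gamma> \<bar> \<Phi> \<turnstile> (y \<^bold>\<in> a)"
  unfolding complemented_subset_fm_def by (rule subset_D[OF AndE1])

text \<open>If \<open>d\<close> is a complement of \<open>b\<close> in \<open>a\<close>, then
  \<open>y\<close> lies in \<open>b \<union> d\<close>. In the first case \<open>y \<in> b\<close>;
  in the second \<open>y \<in> b\<close> would put \<open>y\<close> into the empty
  intersection.\<close>

lemma complemented_subset_dec:
  assumes "\<Gamma> \<bar> \<Phi> \<turnstile> complemented_subset_fm U b a" "\<Gamma> \<bar> \<Phi> \<turnstile> (y \<^bold>\<in> a)"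
  shows "\<Gamma> \<bar> \<Phi> \<turnstile> (y \<^bold>\<in> b \<^bold>\<or> \<^bold>\<not> (y \<^bold>\<in> b))"
proof -
  have ty: "tyof a \<Gamma> = Some (Pow U)" "tyof b \<Gamma> = Some (Pow U)"
    using entails_Om[OF assms(1)] by (auto split: if_splits)
  have y: "tyof y \<Gamma> = Some U" using assms(2) ty(1) by (rule mem_typedD)
  \<comment> \<open>\<open>?d\<close> is the complement supplied by the existential; all other terms
    are lifted past it.\<close>
  let ?b = "lift b" and ?y = "lift y" and ?d = "Var 0"
  let ?D = "subset_fm U ?d (lift a) \<^bold>\<and> union_tm U ?b ?d \<^bold>= lift a \<^bold>\<and> inter_tm U ?b ?d \<^bold>= empty_tm U"
  let ?G = "Pow U # \<Gamma>" and ?P = "?D # map lift \<Phi>"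
  show ?thesis
  proof (rule ExE_tyof)
    show "\<Gamma> \<bar> \<Phi> \<turnstile> (\<^bold>\<exists>[Pow U] ?D)"
      using assms(1) unfolding complemented_subset_fm_def by (rule AndE2)
    have tD: "tyof ?D ?G = Some Om" using ty by simp
    then have D: "?G \<bar> ?P \<turnstile> ?D"
      by (intro entails_hyp) (use entails_wf[OF assms(1)] in auto)
    have un: "?G \<bar> ?P \<turnstile> (lift a \<^bold>= union_tm U ?b ?d)"
      by (rule eq_sym, rule AndE1, rule AndE2, rule D)
    have int: "?G \<bar> ?P \<turnstile> (inter_tm U ?b ?d \<^bold>= empty_tm U)"
      by (rule AndE2, rule AndE2, rule D)
    have "?G \<bar> ?P \<turnstile> (?y \<^bold>\<in> lift a)"
      using entails_lift_cons[OF assms(2) tD] by simp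
    then have "?G \<bar> ?P \<turnstile> (?y \<^bold>\<in> ?b \<^bold>\<or> ?y \<^bold>\<in> ?d)"
      by (rule mem_union_D[OF eq_mem_right[OF un]])
    then have "?G \<bar> ?P \<turnstile> (?y \<^bold>\<in> ?b \<^bold>\<or> \<^bold>\<not> (?y \<^bold>\<in> ?b))"
    proof (rule OrE_hyp)
      show "?G \<bar> (?y \<^bold>\<in> ?b) # ?P \<turnstile> (?y \<^bold>\<in> ?b \<^bold>\<or> \<^bold>\<not> (?y \<^bold>\<in> ?b))"
        if "?G \<bar> (?y \<^bold>\<in> ?b) # ?P \<turnstile> (?y \<^bold>\<in> ?b)"
        using that by (rule OrI1_tyof) (simp add: ty y)
      assume h: "?G \<bar> (?y \<^bold>\<in> ?d) # ?P \<turnstile> (?y \<^bold>\<in> ?d)"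
      show "?G \<bar> (?y \<^bold>\<in> ?d) # ?P \<turnstile> (?y \<^bold>\<in> ?b \<^bold>\<or> \<^bold>\<not> (?y \<^bold>\<in> ?b))"
      proof (rule OrI2_tyof, rule ImpI_hyp)
        assume h': "?G \<bar> (?y \<^bold>\<in> ?b) # (?y \<^bold>\<in> ?d) # ?P \<turnstile> (?y \<^bold>\<in> ?b)"
        have "?G \<bar> (?y \<^bold>\<in> ?b) # (?y \<^bold>\<in> ?d) # ?P \<turnstile> (inter_tm U ?b ?d \<^bold>= empty_tm U)"
          by (intro entails_cons int) (simp_all add: ty y)
        moreover have "?G \<bar> (?y \<^bold>\<in> ?b) # (?y \<^bold>\<in> ?d) # ?P \<turnstile> (?y \<^bold>\<in> inter_tm U ?b ?d)"
          by (intro mem_inter_I h' entails_cons[OF h]) (simp_all add: ty y)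
        ultimately show "?G \<bar> (?y \<^bold>\<in> ?b) # (?y \<^bold>\<in> ?d) # ?P \<turnstile> \<^bold>\<bottom>"
          by (rule mem_empty_D[OF eq_mem_right])
      qed (use entails_wf[OF h] in \<open>simp_all add: ty y\<close>)
    qed
    then show "?G \<bar> ?P \<turnstile> lift (y \<^bold>\<in> b \<^bold>\<or> \<^bold>\<not> (y \<^bold>\<in> b))" by simp
  qed (simp add: ty y)
qed

text \<open>Converse of \<open>complemented_subset_dec\<close>: a subset on which membership is
  decidable is complemented. From here on complements are handled only through this
  characterisation.\<close>

lemma complemented_subset_I:
  assumes sub: "U # \<Gamma> \<bar> (Var 0 \<^bold>\<in> lift b) # map lift \<Phi> \<turnstile> (Var 0 \<^bold>\<in> lift a)"
    and dec: "U # \<Gamma> \<bar> (Var 0 \<^bold>\<in> lift a) # map lift \<Phi> \<turnstile> (Var 0 \<^bold>\<in> lift b \<^bold>\<or> \<^bold>\<not> (Var 0 \<^bold>\<in> lift b))"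
  shows "\<Gamma> \<bar> \<Phi> \<turnstile> complemented_subset_fm U b a"
proof -
  have ty: "tyof a \<Gamma> = Some (Pow U)" "tyof b \<Gamma> = Some (Pow U)"
    using entails_typed[OF sub] by (auto split: if_splits)
  have wf: "wf_hyps \<Gamma> \<Phi>" using entails_wf[OF sub] by simp
  \<comment> \<open>The relative pseudo-complement of \<open>b\<close> in \<open>a\<close>; any
    complement of \<open>b\<close> in \<open>a\<close> has to be this set.\<close>
  define d where "d = \<^bold>{[U] Var 0 \<^bold>\<in> lift a \<^bold>\<and> \<^bold>\<not> (Var 0 \<^bold>\<in> lift b)\<^bold>}"
  have d: "tyof d \<Gamma> = Some (Pow U)" using ty by (simp add: d_def)
  have mem_d: "(U # \<Gamma> \<bar> \<Psi> \<turnstile> (Var 0 \<^bold>\<in> lift d)) =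
      (U # \<Gamma> \<bar> \<Psi> \<turnstile> (Var 0 \<^bold>\<in> lift a \<^bold>\<and> \<^bold>\<not> (Var 0 \<^bold>\<in> lift b)))" for \<Psi>
  proof -
    have "tyof (lift d) (U # \<Gamma>) = Some (Pow U)" using d by simp
    then show ?thesis unfolding d_def
      by (simp, subst compr_iff) (simp_all add: inst_def split: if_splits)
  qed
  have "\<Gamma> \<bar> \<Phi> \<turnstile> subset_fm U b a"
    unfolding subset_fm_def using sub by (intro AllI ImpI)
  moreover have "\<Gamma> \<bar> \<Phi> \<turnstile> subset_fm U d a"
    unfolding subset_fm_def
  proof (intro AllI ImpI_hyp)
    assume "U # \<Gamma> \<bar> (Var 0 \<^bold>\<in> lift d) # map lift \<Phi> \<turnstile> (Var 0 \<^bold>\<in> lift d)"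
    then show "U # \<Gamma> \<bar> (Var 0 \<^bold>\<in> lift d) # map lift \<Phi> \<turnstile> (Var 0 \<^bold>\<in> lift a)"
      unfolding mem_d by (rule AndE1)
  qed (simp_all add: d wf)
  moreover have "\<Gamma> \<bar> \<Phi> \<turnstile> (union_tm U b d \<^bold>= a)"
  proof (rule set_eqI)
    let ?u = "Var 0 \<^bold>\<in> union_tm U (lift b) (lift d)"
    have "U # \<Gamma> \<bar> ?u # map lift \<Phi> \<turnstile> ?u"
      by (rule entails_hyp) (simp_all add: wf ty d)
    then have "U # \<Gamma> \<bar> ?u # map lift \<Phi> \<turnstile> (Var 0 \<^bold>\<in> lift a)"
    proof (rule OrE_hyp[OF mem_union_D])
      show "U # \<Gamma> \<bar> (Var 0 \<^bold>\<in> lift b) # ?u # map lift \<Phi> \<turnstile> (Var 0 \<^bold>\<in> lift a)"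
        using sub by (rule entails_weaken) (auto simp: ty d wf)
      show "U # \<Gamma> \<bar> (Var 0 \<^bold>\<in> lift d) # ?u # map lift \<Phi> \<turnstile> (Var 0 \<^bold>\<in> lift a)"
        if "U # \<Gamma> \<bar> (Var 0 \<^bold>\<in> lift d) # ?u # map lift \<Phi> \<turnstile> (Var 0 \<^bold>\<in> lift d)"
        using that unfolding mem_d by (rule AndE1)
    qed
    then show "U # \<Gamma> \<bar> (Var 0 \<^bold>\<in> lift (union_tm U b d)) # map lift \<Phi> \<turnstile> (Var 0 \<^bold>\<in> lift a)"
      by simp
    let ?a = "Var 0 \<^bold>\<in> lift a"
    \<comment> \<open>This inclusion of \<open>a\<close> in \<open>b \<union> d\<close> is the one
      place where decidability enters.\<close>
    have "U # \<Gamma> \<bar> ?a # map lift \<Phi> \<turnstile> ?u"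
      using dec
    proof (rule OrE_hyp)
      show "U # \<Gamma> \<bar> (Var 0 \<^bold>\<in> lift b) # ?a # map lift \<Phi> \<turnstile> ?u"
        if "U # \<Gamma> \<bar> (Var 0 \<^bold>\<in> lift b) # ?a # map lift \<Phi> \<turnstile> (Var 0 \<^bold>\<in> lift b)"
        using that by (rule mem_union_I1) (simp_all add: ty d)
      assume h: "U # \<Gamma> \<bar> (\<^bold>\<not> (Var 0 \<^bold>\<in> lift b)) # ?a # map lift \<Phi> \<turnstile> \<^bold>\<not> (Var 0 \<^bold>\<in> lift b)"
      have "U # \<Gamma> \<bar> (\<^bold>\<not> (Var 0 \<^bold>\<in> lift b)) # ?a # map lift \<Phi> \<turnstile> ?a"
        by (rule entails_hyp) (simp_all add: ty wf)
      then show "U # \<Gamma> \<bar> (\<^bold>\<not> (Var 0 \<^bold>\<in> lift b)) # ?a # map lift \<Phi> \<turnstile> ?u"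
        by (intro mem_union_I2, unfold mem_d) (use h in \<open>auto simp: ty d intro: AndI\<close>)
    qed
    then show "U # \<Gamma> \<bar> ?a # map lift \<Phi> \<turnstile> (Var 0 \<^bold>\<in> lift (union_tm U b d))" by simp
  qed
  moreover have "\<Gamma> \<bar> \<Phi> \<turnstile> (inter_tm U b d \<^bold>= empty_tm U)"
  proof (rule set_eqI)
    let ?i = "Var 0 \<^bold>\<in> inter_tm U (lift b) (lift d)"
    have i: "U # \<Gamma> \<bar> ?i # map lift \<Phi> \<turnstile> ?i"
      by (rule entails_hyp) (simp_all add: wf ty d)
    have "U # \<Gamma> \<bar> ?i # map lift \<Phi> \<turnstile> \<^bold>\<bottom>"
      by (rule ImpE[OF AndE2[OF mem_inter_D(2)[OF i, unfolded mem_d]] mem_inter_D(1)[OF i]])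
    then show "U # \<Gamma> \<bar> (Var 0 \<^bold>\<in> lift (inter_tm U b d)) # map lift \<Phi> \<turnstile> (Var 0 \<^bold>\<in> lift (empty_tm U))"
      by (auto intro: BotE_tyof)
    let ?e = "Var 0 \<^bold>\<in> empty_tm U"
    have "U # \<Gamma> \<bar> ?e # map lift \<Phi> \<turnstile> ?e"
      by (rule entails_hyp) (simp_all add: wf)
    from BotE_tyof[OF mem_empty_D[OF this]]
    show "U # \<Gamma> \<bar> (Var 0 \<^bold>\<in> lift (empty_tm U)) # map lift \<Phi> \<turnstile> (Var 0 \<^bold>\<in> lift (inter_tm U b d))"
      by (simp add: ty d)
  qed
  ultimately show ?thesis unfolding complemented_subset_fm_def
    by (intro AndI ExI_tyof[where a = d]) (simp_all add: inst_def ty d AndI)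
qed

lemma complemented_subset_typed:
  assumes "\<Gamma> \<bar> \<Phi> \<turnstile> complemented_subset_fm U b a"
  shows "tyof b \<Gamma> = Some (Pow U)" "tyof a \<Gamma> = Some (Pow U)"
  using entails_Om[OF assms] by (auto split: if_splits)

text \<open>Every set is one of its own complemented subsets, which is how the main theorem gets
  from hereditary sets to membership of the sets themselves.\<close>

lemma complemented_subset_refl:
  assumes "tyof a \<Gamma> = Some (Pow U)" "wf_hyps \<Gamma> \<Phi>"
  shows "\<Gamma> \<bar> \<Phi> \<turnstile> complemented_subset_fm U a a"
proof (rule complemented_subset_I)
  show a: "U # \<Gamma> \<bar> (Var 0 \<^bold>\<in> lift a) # map lift \<Phi> \<turnstile> (Var 0 \<^bold>\<in> lift a)"
    by (rule entails_hyp) (simp_all add: assms)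
  show "U # \<Gamma> \<bar> (Var 0 \<^bold>\<in> lift a) # map lift \<Phi> \<turnstile> (Var 0 \<^bold>\<in> lift a \<^bold>\<or> \<^bold>\<not> (Var 0 \<^bold>\<in> lift a))"
    by (rule OrI1_tyof[OF a]) (simp add: assms)
qed

text \<open>For \<open>y \<in> a\<close>, first decide \<open>y \<in> b\<close>. If it holds,
  \<open>y \<in> c\<close> is decidable as well; if it fails, so does \<open>y \<in> c\<close>,
  because \<open>c \<subseteq> b\<close>.\<close>

lemma complemented_subset_trans:
  assumes cb: "\<Gamma> \<bar> \<Phi> \<turnstile> complemented_subset_fm U c b"
    and ba: "\<Gamma> \<bar> \<Phi> \<turnstile> complemented_subset_fm U b a"
  shows "\<Gamma> \<bar> \<Phi> \<turnstile> complemented_subset_fm U c a"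
proof (rule complemented_subset_I)
  note ty = complemented_subset_typed[OF cb] complemented_subset_typed[OF ba]
  note wf = entails_wf[OF cb]
  let ?c = "Var 0 \<^bold>\<in> lift c" and ?b = "Var 0 \<^bold>\<in> lift b" and ?a = "Var 0 \<^bold>\<in> lift a"
  have cb': "U # \<Gamma> \<bar> \<psi> # map lift \<Phi> \<turnstile> complemented_subset_fm U (lift c) (lift b)"
    and ba': "U # \<Gamma> \<bar> \<psi> # map lift \<Phi> \<turnstile> complemented_subset_fm U (lift b) (lift a)"
    if "tyof \<psi> (U # \<Gamma>) = Some Om" for \<psi>
    using entails_lift_cons[OF cb that] entails_lift_cons[OF ba that] by simp_all
  have "U # \<Gamma> \<bar> ?c # map lift \<Phi> \<turnstile> ?c"
    by (rule entails_hyp) (simp_all add: ty wf)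
  then show "U # \<Gamma> \<bar> ?c # map lift \<Phi> \<turnstile> ?a"
    by (intro complemented_subset_D[OF ba'] complemented_subset_D[OF cb']) (simp_all add: ty)
  have "U # \<Gamma> \<bar> ?a # map lift \<Phi> \<turnstile> ?a"
    by (rule entails_hyp) (simp_all add: ty wf)
  then have "U # \<Gamma> \<bar> ?a # map lift \<Phi> \<turnstile> (?b \<^bold>\<or> \<^bold>\<not> ?b)"
    by (rule complemented_subset_dec[OF ba', rotated]) (simp add: ty)
  then show "U # \<Gamma> \<bar> ?a # map lift \<Phi> \<turnstile> (?c \<^bold>\<or> \<^bold>\<not> ?c)"
  proof (rule OrE_hyp)
    assume "U # \<Gamma> \<bar> ?b # ?a # map lift \<Phi> \<turnstile> ?b"
    then show "U # \<Gamma> \<bar> ?b # ?a # map lift \<Phi> \<turnstile> (?c \<^bold>\<or> \<^bold>\<not> ?c)"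
      by (rule complemented_subset_dec[OF entails_cons[OF cb'], rotated 2]) (simp_all add: ty)
  next
    assume nb: "U # \<Gamma> \<bar> (\<^bold>\<not> ?b) # ?a # map lift \<Phi> \<turnstile> \<^bold>\<not> ?b"
    show "U # \<Gamma> \<bar> (\<^bold>\<not> ?b) # ?a # map lift \<Phi> \<turnstile> (?c \<^bold>\<or> \<^bold>\<not> ?c)"
    proof (rule OrI2_tyof, rule ImpI_hyp)
      let ?P = "?c # (\<^bold>\<not> ?b) # ?a # map lift \<Phi>"
      assume "U # \<Gamma> \<bar> ?P \<turnstile> ?c"
      then have "U # \<Gamma> \<bar> ?P \<turnstile> ?b"
        by (rule complemented_subset_D[OF entails_cons[OF entails_cons[OF cb']], rotated 3])
          (simp_all add: ty)
      moreover have "U # \<Gamma> \<bar> ?P \<turnstile> \<^bold>\<not> ?b"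
        by (rule entails_cons[OF nb]) (simp add: ty)
      ultimately show "U # \<Gamma> \<bar> ?P \<turnstile> \<^bold>\<bottom>" by (rule ImpE[rotated])
    qed (simp_all add: ty wf)
  qed
qed

section \<open>Complemented subsets of a set with one element added\<close>

lemma complemented_subset_insert_typed:
  assumes "\<Gamma> \<bar> \<Phi> \<turnstile> complemented_subset_fm U c (insert_tm U b x)"
  shows "tyof c \<Gamma> = Some (Pow U)" "tyof b \<Gamma> = Some (Pow U)" "tyof x \<Gamma> = Some U"
  using entails_Om[OF assms] by (auto split: if_splits)

text \<open>The new element \<open>x\<close> itself lies in the larger set, so its membership in
  \<open>c\<close> is decidable. This supplies the case distinction of the induction step, although
  equality in \<open>U\<close> need not be decidable.\<close>

lemma complemented_subset_insert_dec:
  assumes "\<Gamma> \<bar> \<Phi> \<turnstile> complemented_subset_fm U c (insert_tm U b x)"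
  shows "\<Gamma> \<bar> \<Phi> \<turnstile> (x \<^bold>\<in> c \<^bold>\<or> \<^bold>\<not> (x \<^bold>\<in> c))"
  using complemented_subset_insert_typed[OF assms] entails_wf[OF assms]
  by (intro complemented_subset_dec[OF assms] mem_insert_I2 EqI_tyof)

text \<open>An element of \<open>c\<close> lies in \<open>b\<close> or equals \<open>x\<close>, and
  the second alternative contradicts \<open>x \<notin> c\<close>. Decidability is inherited, since
  \<open>b\<close> is contained in the larger set.\<close>

lemma complemented_subset_of_insert:
  assumes cb: "\<Gamma> \<bar> \<Phi> \<turnstile> complemented_subset_fm U c (insert_tm U b x)"
    and x: "\<Gamma> \<bar> \<Phi> \<turnstile> \<^bold>\<not> (x \<^bold>\<in> c)"
  shows "\<Gamma> \<bar> \<Phi> \<turnstile> complemented_subset_fm U c b"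
proof (rule complemented_subset_I)
  note ty = complemented_subset_insert_typed[OF cb]
  note wf = entails_wf[OF cb]
  let ?c = "Var 0 \<^bold>\<in> lift c" and ?b = "Var 0 \<^bold>\<in> lift b" and ?e = "Var 0 \<^bold>= lift x"
  have cb': "U # \<Gamma> \<bar> \<psi> # map lift \<Phi> \<turnstile>
      complemented_subset_fm U (lift c) (insert_tm U (lift b) (lift x))"
    if "tyof \<psi> (U # \<Gamma>) = Some Om" for \<psi>
    using entails_lift_cons[OF cb that] by simp
  have c: "U # \<Gamma> \<bar> ?c # map lift \<Phi> \<turnstile> ?c"
    by (rule entails_hyp) (simp_all add: ty wf)
  have "U # \<Gamma> \<bar> ?c # map lift \<Phi> \<turnstile> (?b \<^bold>\<or> ?e)"
    by (rule mem_insert_D[OF complemented_subset_D[OF cb' c]]) (simp add: ty)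
  then show "U # \<Gamma> \<bar> ?c # map lift \<Phi> \<turnstile> ?b"
  proof (rule OrE_hyp)
    assume e: "U # \<Gamma> \<bar> ?e # ?c # map lift \<Phi> \<turnstile> ?e"
    have tc: "tyof ?c (U # \<Gamma>) = Some Om" and te: "tyof ?e (U # \<Gamma>) = Some Om"
      by (simp_all add: ty)
    have "U # \<Gamma> \<bar> ?e # ?c # map lift \<Phi> \<turnstile> \<^bold>\<not> (lift x \<^bold>\<in> lift c)"
      using entails_cons[OF entails_lift_cons[OF x tc] te] by simp
    then have "U # \<Gamma> \<bar> ?e # ?c # map lift \<Phi> \<turnstile> \<^bold>\<bottom>"
      by (rule ImpE) (rule eq_mem_left[OF e entails_cons[OF c te]])
    then show "U # \<Gamma> \<bar> ?e # ?c # map lift \<Phi> \<turnstile> ?b"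
      by (rule BotE_tyof) (simp add: ty)
  qed
  have "U # \<Gamma> \<bar> ?b # map lift \<Phi> \<turnstile> ?b"
    by (rule entails_hyp) (simp_all add: ty wf)
  then show "U # \<Gamma> \<bar> ?b # map lift \<Phi> \<turnstile> (?c \<^bold>\<or> \<^bold>\<not> ?c)"
    by (intro complemented_subset_dec[OF cb'] mem_insert_I1) (simp_all add: ty)
qed

text \<open>For an element of \<open>b\<close>, belonging to the intersection amounts to belonging
  to \<open>c\<close>, which is decidable on the larger set.\<close>

lemma complemented_subset_inter:
  assumes cb: "\<Gamma> \<bar> \<Phi> \<turnstile> complemented_subset_fm U c (insert_tm U b x)"
  shows "\<Gamma> \<bar> \<Phi> \<turnstile> complemented_subset_fm U (inter_tm U c b) b"
proof -
  note ty = complemented_subset_insert_typed[OF cb]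
  note wf = entails_wf[OF cb]
  let ?c = "Var 0 \<^bold>\<in> lift c" and ?b = "Var 0 \<^bold>\<in> lift b"
  let ?i = "Var 0 \<^bold>\<in> inter_tm U (lift c) (lift b)"
  have cb': "U # \<Gamma> \<bar> ?b # map lift \<Phi> \<turnstile>
      complemented_subset_fm U (lift c) (insert_tm U (lift b) (lift x))"
    using entails_lift_cons[OF cb, of ?b U] by (simp add: ty)
  have b: "U # \<Gamma> \<bar> ?b # map lift \<Phi> \<turnstile> ?b"
    by (rule entails_hyp) (simp_all add: ty wf)
  have i: "U # \<Gamma> \<bar> ?i # map lift \<Phi> \<turnstile> ?i"
    by (rule entails_hyp) (simp_all add: ty wf)
  have "U # \<Gamma> \<bar> ?b # map lift \<Phi> \<turnstile> (?c \<^bold>\<or> \<^bold>\<not> ?c)"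
    using b by (intro complemented_subset_dec[OF cb'] mem_insert_I1) (simp_all add: ty)
  then have "U # \<Gamma> \<bar> ?b # map lift \<Phi> \<turnstile> (?i \<^bold>\<or> \<^bold>\<not> ?i)"
  proof (rule OrE_hyp)
    assume c: "U # \<Gamma> \<bar> ?c # ?b # map lift \<Phi> \<turnstile> ?c"
    show "U # \<Gamma> \<bar> ?c # ?b # map lift \<Phi> \<turnstile> (?i \<^bold>\<or> \<^bold>\<not> ?i)"
      by (intro OrI1_tyof mem_inter_I c entails_cons[OF b]) (simp_all add: ty)
  next
    assume nc: "U # \<Gamma> \<bar> (\<^bold>\<not> ?c) # ?b # map lift \<Phi> \<turnstile> \<^bold>\<not> ?c"
    show "U # \<Gamma> \<bar> (\<^bold>\<not> ?c) # ?b # map lift \<Phi> \<turnstile> (?i \<^bold>\<or> \<^bold>\<not> ?i)"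
    proof (rule OrI2_tyof, rule ImpI_hyp)
      assume i': "U # \<Gamma> \<bar> ?i # (\<^bold>\<not> ?c) # ?b # map lift \<Phi> \<turnstile> ?i"
      have "U # \<Gamma> \<bar> ?i # (\<^bold>\<not> ?c) # ?b # map lift \<Phi> \<turnstile> \<^bold>\<not> ?c"
        by (rule entails_cons[OF nc]) (simp add: ty)
      then show "U # \<Gamma> \<bar> ?i # (\<^bold>\<not> ?c) # ?b # map lift \<Phi> \<turnstile> \<^bold>\<bottom>"
        by (rule ImpE) (rule mem_inter_D(1)[OF i'])
    qed (simp_all add: ty wf)
  qed
  then show ?thesis
    using mem_inter_D(2)[OF i] by (intro complemented_subset_I) simp_all
qed

text \<open>The inclusion from left to right uses \<open>x \<in> c\<close>; the other one uses that
  each element of \<open>c\<close> lies in \<open>b\<close> or equals \<open>x\<close>.\<close>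

lemma insert_inter_eq:
  assumes cb: "\<Gamma> \<bar> \<Phi> \<turnstile> complemented_subset_fm U c (insert_tm U b x)"
    and x: "\<Gamma> \<bar> \<Phi> \<turnstile> (x \<^bold>\<in> c)"
  shows "\<Gamma> \<bar> \<Phi> \<turnstile> (insert_tm U (inter_tm U c b) x \<^bold>= c)"
proof -
  note ty = complemented_subset_insert_typed[OF cb]
  note wf = entails_wf[OF cb]
  let ?c = "Var 0 \<^bold>\<in> lift c" and ?b = "Var 0 \<^bold>\<in> lift b" and ?e = "Var 0 \<^bold>= lift x"
  let ?i = "Var 0 \<^bold>\<in> inter_tm U (lift c) (lift b)"
  let ?j = "Var 0 \<^bold>\<in> insert_tm U (inter_tm U (lift c) (lift b)) (lift x)"
  have tj: "tyof ?j (U # \<Gamma>) = Some Om" by (simp add: ty)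
  have "U # \<Gamma> \<bar> ?j # map lift \<Phi> \<turnstile> ?j"
    by (rule entails_hyp) (simp_all add: ty wf)
  then have "U # \<Gamma> \<bar> ?j # map lift \<Phi> \<turnstile> ?c"
  proof (rule OrE_hyp[OF mem_insert_D])
    show "U # \<Gamma> \<bar> ?i # ?j # map lift \<Phi> \<turnstile> ?c" if "U # \<Gamma> \<bar> ?i # ?j # map lift \<Phi> \<turnstile> ?i"
      using that by (rule mem_inter_D)
    assume "U # \<Gamma> \<bar> ?e # ?j # map lift \<Phi> \<turnstile> ?e"
    moreover have "U # \<Gamma> \<bar> ?e # ?j # map lift \<Phi> \<turnstile> (lift x \<^bold>\<in> lift c)"
      using entails_cons[OF entails_lift_cons[OF x tj], of ?e] by (simp add: ty)
    ultimately show "U # \<Gamma> \<bar> ?e # ?j # map lift \<Phi> \<turnstile> ?c" by (rule eq_mem_left[OF eq_sym])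
  qed
  moreover have "U # \<Gamma> \<bar> ?c # map lift \<Phi> \<turnstile> ?j"
  proof -
    have c: "U # \<Gamma> \<bar> ?c # map lift \<Phi> \<turnstile> ?c"
      by (rule entails_hyp) (simp_all add: ty wf)
    have "U # \<Gamma> \<bar> ?c # map lift \<Phi> \<turnstile>
        complemented_subset_fm U (lift c) (insert_tm U (lift b) (lift x))"
      using entails_lift_cons[OF cb, of ?c U] by (simp add: ty)
    from mem_insert_D[OF complemented_subset_D[OF this c]] show ?thesis
    proof (rule OrE_hyp)
      assume b: "U # \<Gamma> \<bar> ?b # ?c # map lift \<Phi> \<turnstile> ?b"
      show "U # \<Gamma> \<bar> ?b # ?c # map lift \<Phi> \<turnstile> ?j"
        by (intro mem_insert_I1 mem_inter_I b entails_cons[OF c]) (simp_all add: ty)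
    next
      assume e: "U # \<Gamma> \<bar> ?e # ?c # map lift \<Phi> \<turnstile> ?e"
      show "U # \<Gamma> \<bar> ?e # ?c # map lift \<Phi> \<turnstile> ?j"
        by (intro mem_insert_I2 e) (simp_all add: ty)
    qed
  qed
  ultimately show ?thesis by (intro set_eqI) simp_all
qed

text \<open>If \<open>c \<inter> b\<close> were equal to \<open>b\<close>, then adding
  \<open>x\<close> to both would give \<open>c = b \<union> {x}\<close> by
  \<open>insert_inter_eq\<close>, against properness of \<open>c\<close>.\<close>

lemma complemented_proper_subset_inter:
  assumes cb: "\<Gamma> \<bar> \<Phi> \<turnstile> complemented_proper_subset_fm U c (insert_tm U b x)"
    and x: "\<Gamma> \<bar> \<Phi> \<turnstile> (x \<^bold>\<in> c)"
  shows "\<Gamma> \<bar> \<Phi> \<turnstile> complemented_proper_subset_fm U (inter_tm U c b) b"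
  unfolding complemented_proper_subset_fm_def
proof (rule AndI)
  note cb' = AndE1[OF cb[unfolded complemented_proper_subset_fm_def]]
  note ne = AndE2[OF cb[unfolded complemented_proper_subset_fm_def]]
  note ty = complemented_subset_insert_typed[OF cb']
  show "\<Gamma> \<bar> \<Phi> \<turnstile> complemented_subset_fm U (inter_tm U c b) b"
    using cb' by (rule complemented_subset_inter)
  let ?E = "inter_tm U c b \<^bold>= b"
  show "\<Gamma> \<bar> \<Phi> \<turnstile> \<^bold>\<not> ?E"
  proof (rule ImpI_hyp)
    assume E: "\<Gamma> \<bar> ?E # \<Phi> \<turnstile> ?E"
    have "\<Gamma> \<bar> ?E # \<Phi> \<turnstile> (insert_tm U (inter_tm U c b) x \<^bold>= c)"
      using insert_inter_eq[OF cb' x] by (rule entails_cons) (simp add: ty)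
    then have "\<Gamma> \<bar> ?E # \<Phi> \<turnstile> (insert_tm U b x \<^bold>= c)"
      \<comment> \<open>Replaces \<open>c \<inter> b\<close> by \<open>b\<close> inside the equation
        \<open>insert z x = c\<close>, read as a formula in \<open>z\<close>.\<close>
      using EqE_tyof[OF E, where A = "Pow U" and \<phi> = "insert_tm U (Var 0) (lift x) \<^bold>= lift c"]
      by (simp add: inst_def ty)
    then have "\<Gamma> \<bar> ?E # \<Phi> \<turnstile> (c \<^bold>= insert_tm U b x)" by (rule eq_sym)
    moreover have "\<Gamma> \<bar> ?E # \<Phi> \<turnstile> \<^bold>\<not> (c \<^bold>= insert_tm U b x)"
      using ne by (rule entails_cons) (simp add: ty)
    ultimately show "\<Gamma> \<bar> ?E # \<Phi> \<turnstile> \<^bold>\<bottom>" by (rule ImpE[rotated])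
  qed (use entails_wf[OF cb] in \<open>simp_all add: ty\<close>)
qed


subsection \<open>Kuratowski induction\<close>

text \<open>The closure condition inside \<open>Fin_tm\<close>, stated for an arbitrary family term
  so that it can be instantiated.\<close>

definition Fin_closed_fm :: "'g ty \<Rightarrow> 'g tm \<Rightarrow> 'g tm" where
  "Fin_closed_fm U F = (empty_tm U \<^bold>\<in> F \<^bold>\<and>
     (\<^bold>\<forall>[Pow U] \<^bold>\<forall>[U] (Var 1 \<^bold>\<in> lift (lift F) \<^bold>\<longrightarrow> insert_tm U (Var 1) (Var 0) \<^bold>\<in> lift (lift F))))"

lemma Fin_tm_eq:
  "Fin_tm U = \<^bold>{[Pow U] \<^bold>\<forall>[Pow (Pow U)] (Fin_closed_fm U (Var 0) \<^bold>\<longrightarrow> Var 1 \<^bold>\<in> Var 0)\<^bold>}"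
  \<comment> \<open>Lifting \<open>Var 0\<close> twice gives \<open>Var (Suc (Suc 0))\<close>, which
    has to match the numeral in \<open>Var 2\<close>.\<close>
  by (simp add: Fin_tm_def Fin_closed_fm_def insert_tm_def numeral_2_eq_2)

lemma Fin_closed_simps [simp]:
  "ren r (Fin_closed_fm U F) = Fin_closed_fm U (ren r F)"
  "sub \<sigma> (Fin_closed_fm U F) = Fin_closed_fm U (sub \<sigma> F)"
  "tyof (Fin_closed_fm U F) \<Gamma> = (if tyof F \<Gamma> = Some (Pow (Pow U)) then Some Om else None)"
  by (simp_all add: Fin_closed_fm_def)

lemma Fin_tm_simps [simp]:
  "ren r (Fin_tm U) = Fin_tm U"
  "sub \<sigma> (Fin_tm U) = Fin_tm U"
  "tyof (Fin_tm U) \<Gamma> = Some (Pow (Pow U))"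
  by (simp_all add: Fin_tm_eq)

lemma Fin_closed_empty: "\<Gamma> \<bar> \<Phi> \<turnstile> Fin_closed_fm U F \<Longrightarrow> \<Gamma> \<bar> \<Phi> \<turnstile> (empty_tm U \<^bold>\<in> F)"
  unfolding Fin_closed_fm_def by (rule AndE1)

lemma Fin_closed_insert:
  assumes "\<Gamma> \<bar> \<Phi> \<turnstile> Fin_closed_fm U F" "\<Gamma> \<bar> \<Phi> \<turnstile> (b \<^bold>\<in> F)" "tyof x \<Gamma> = Some U"
  shows "\<Gamma> \<bar> \<Phi> \<turnstile> (insert_tm U b x \<^bold>\<in> F)"
proof -
  have "tyof F \<Gamma> = Some (Pow (Pow U))"
    using entails_Om[OF assms(1)] by (simp split: if_splits)
  with assms(2) have b: "tyof b \<Gamma> = Some (Pow U)" by (rule mem_typedD)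
  have "\<Gamma> \<bar> \<Phi> \<turnstile> (\<^bold>\<forall>[U] (lift b \<^bold>\<in> lift F \<^bold>\<longrightarrow> insert_tm U (lift b) (Var 0) \<^bold>\<in> lift F))"
    using AllE_tyof[OF AndE2[OF assms(1)[unfolded Fin_closed_fm_def]] b] by (simp add: inst_def)
  from AllE_tyof[OF this assms(3)] show ?thesis
    using assms(2) by (simp add: inst_def ImpE)
qed

text \<open>The induction principle for finite sets, available for every family that is the value of
  a term.\<close>

lemma Fin_D:
  assumes "\<Gamma> \<bar> \<Phi> \<turnstile> (b \<^bold>\<in> Fin_tm U)" "\<Gamma> \<bar> \<Phi> \<turnstile> Fin_closed_fm U F"
  shows "\<Gamma> \<bar> \<Phi> \<turnstile> (b \<^bold>\<in> F)"
proof -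
  have F: "tyof F \<Gamma> = Some (Pow (Pow U))"
    using entails_Om[OF assms(2)] by (simp split: if_splits)
  have "\<Gamma> \<bar> \<Phi> \<turnstile> (\<^bold>\<forall>[Pow (Pow U)] (Fin_closed_fm U (Var 0) \<^bold>\<longrightarrow> lift b \<^bold>\<in> Var 0))"
    using ComprE[OF assms(1)[unfolded Fin_tm_eq]] by (simp add: inst_def)
  from AllE_tyof[OF this F] show ?thesis
    using assms(2) by (simp add: inst_def ImpE)
qed

lemma Fin_I:
  assumes "tyof b \<Gamma> = Some (Pow U)" "wf_hyps \<Gamma> \<Phi>"
    and "Pow (Pow U) # \<Gamma> \<bar> Fin_closed_fm U (Var 0) # map lift \<Phi> \<turnstile> Fin_closed_fm U (Var 0) \<Longrightarrow>
      Pow (Pow U) # \<Gamma> \<bar> Fin_closed_fm U (Var 0) # map lift \<Phi> \<turnstile> (lift b \<^bold>\<in> Var 0)"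
  shows "\<Gamma> \<bar> \<Phi> \<turnstile> (b \<^bold>\<in> Fin_tm U)"
proof -
  have "\<Gamma> \<bar> \<Phi> \<turnstile> (\<^bold>\<forall>[Pow (Pow U)] (Fin_closed_fm U (Var 0) \<^bold>\<longrightarrow> lift b \<^bold>\<in> Var 0))"
    by (intro AllI ImpI_hyp assms(3)) (simp_all add: assms)
  then show ?thesis
    unfolding Fin_tm_eq using assms(1) by (subst compr_iff) (simp_all add: inst_def)
qed

lemma Fin_empty: "wf_hyps \<Gamma> \<Phi> \<Longrightarrow> \<Gamma> \<bar> \<Phi> \<turnstile> (empty_tm U \<^bold>\<in> Fin_tm U)"
  by (rule Fin_I) (simp_all add: Fin_closed_empty)

text \<open>A closed family contains \<open>b\<close>, as \<open>b\<close> is finite, and hence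
  contains \<open>b \<union> {x}\<close>. Needed because progressiveness speaks only about finite
  sets.\<close>

lemma Fin_insert:
  assumes "\<Gamma> \<bar> \<Phi> \<turnstile> (b \<^bold>\<in> Fin_tm U)" "tyof x \<Gamma> = Some U"
  shows "\<Gamma> \<bar> \<Phi> \<turnstile> (insert_tm U b x \<^bold>\<in> Fin_tm U)"
proof (rule Fin_I)
  have "tyof b \<Gamma> = Some (Pow U)" using assms(1) by (rule mem_typedD) simp
  then show "tyof (insert_tm U b x) \<Gamma> = Some (Pow U)" using assms(2) by simp
  let ?F = "Fin_closed_fm U (Var 0)"
  assume F: "Pow (Pow U) # \<Gamma> \<bar> ?F # map lift \<Phi> \<turnstile> ?F"
  have "Pow (Pow U) # \<Gamma> \<bar> ?F # map lift \<Phi> \<turnstile> (lift b \<^bold>\<in> Fin_tm U)"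
    using entails_lift_cons[OF assms(1), of ?F "Pow (Pow U)"] by simp
  from Fin_closed_insert[OF F Fin_D[OF this F], of "lift x"]
  show "Pow (Pow U) # \<Gamma> \<bar> ?F # map lift \<Phi> \<turnstile> (lift (insert_tm U b x) \<^bold>\<in> Var 0)"
    by (simp add: assms(2))
qed (rule entails_wf[OF assms(1)])


subsection \<open>Progressive families\<close>

text \<open>The inner premise of \<open>progressive_fm\<close>, named because it is the induction
  hypothesis in \<open>extension_proper_subset\<close>.\<close>

definition proper_subsets_in_fm :: "'g ty \<Rightarrow> 'g tm \<Rightarrow> 'g tm \<Rightarrow> 'g tm" where
  "proper_subsets_in_fm U b X =
     (\<^bold>\<forall>[Pow U] (complemented_proper_subset_fm U (Var 0) (lift b) \<^bold>\<longrightarrow> Var 0 \<^bold>\<in> lift X))"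

lemma progressive_fm_eq:
  "progressive_fm U X = (\<^bold>\<forall>[Pow U] (Var 0 \<^bold>\<in> Fin_tm U \<^bold>\<longrightarrow>
     proper_subsets_in_fm U (Var 0) (lift X) \<^bold>\<longrightarrow> Var 0 \<^bold>\<in> lift X))"
  by (simp add: progressive_fm_def proper_subsets_in_fm_def)

lemma proper_subsets_in_simps [simp]:
  "ren r (proper_subsets_in_fm U b X) = proper_subsets_in_fm U (ren r b) (ren r X)"
  "sub \<sigma> (proper_subsets_in_fm U b X) = proper_subsets_in_fm U (sub \<sigma> b) (sub \<sigma> X)"
  "tyof (proper_subsets_in_fm U b X) \<Gamma> =
     (if tyof b \<Gamma> = Some (Pow U) \<and> tyof X \<Gamma> = Some (Pow (Pow U)) then Some Om else None)"
  by (auto simp: proper_subsets_in_fm_def)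

lemma progressive_simps [simp]:
  "ren r (progressive_fm U X) = progressive_fm U (ren r X)"
  "sub \<sigma> (progressive_fm U X) = progressive_fm U (sub \<sigma> X)"
  "tyof (progressive_fm U X) \<Gamma> = (if tyof X \<Gamma> = Some (Pow (Pow U)) then Some Om else None)"
  by (auto simp: progressive_fm_eq)

lemma proper_subsets_in_D:
  assumes "\<Gamma> \<bar> \<Phi> \<turnstile> proper_subsets_in_fm U b X" "\<Gamma> \<bar> \<Phi> \<turnstile> complemented_proper_subset_fm U c b"
  shows "\<Gamma> \<bar> \<Phi> \<turnstile> (c \<^bold>\<in> X)"
proof -
  have "tyof c \<Gamma> = Some (Pow U)" using entails_Om[OF assms(2)] by (simp split: if_splits)
  from AllE_tyof[OF assms(1)[unfolded proper_subsets_in_fm_def] this] show ?thesis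
    using assms(2) by (simp add: inst_def ImpE)
qed

lemma progressive_D:
  assumes "\<Gamma> \<bar> \<Phi> \<turnstile> progressive_fm U X" "\<Gamma> \<bar> \<Phi> \<turnstile> (b \<^bold>\<in> Fin_tm U)"
    and "Pow U # \<Gamma> \<bar> complemented_proper_subset_fm U (Var 0) (lift b) # map lift \<Phi> \<turnstile>
        complemented_proper_subset_fm U (Var 0) (lift b) \<Longrightarrow>
      Pow U # \<Gamma> \<bar> complemented_proper_subset_fm U (Var 0) (lift b) # map lift \<Phi> \<turnstile>
        (Var 0 \<^bold>\<in> lift X)"
  shows "\<Gamma> \<bar> \<Phi> \<turnstile> (b \<^bold>\<in> X)"
proof -
  have b: "tyof b \<Gamma> = Some (Pow U)" using assms(2) by (rule mem_typedD) simp
  have "\<Gamma> \<bar> \<Phi> \<turnstile> (b \<^bold>\<in> Fin_tm U \<^bold>\<longrightarrow> proper_subsets_in_fm U b X \<^bold>\<longrightarrow> b \<^bold>\<in> X)"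
    using AllE_tyof[OF assms(1)[unfolded progressive_fm_eq] b] by (simp add: inst_def)
  moreover have "\<Gamma> \<bar> \<Phi> \<turnstile> proper_subsets_in_fm U b X"
    unfolding proper_subsets_in_fm_def
    by (intro AllI ImpI_hyp assms(3)) (use entails_wf[OF assms(1)] b in simp_all)
  ultimately show ?thesis using assms(2) by (blast intro: ImpE)
qed

text \<open>The family is quantified inside the formula because the induction step applies one
  hypothesis on \<open>a\<close> to two families. Ranging over all complemented subsets of
  \<open>a\<close>, not just \<open>a\<close>, covers those subsets of \<open>a \<union> {x}\<close>
  that omit \<open>x\<close>.\<close>

definition hereditary_fm :: "'g ty \<Rightarrow> 'g tm \<Rightarrow> 'g tm" where
  "hereditary_fm U a = (\<^bold>\<forall>[Pow (Pow U)] (progressive_fm U (Var 0) \<^bold>\<longrightarrow>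
     (\<^bold>\<forall>[Pow U] (complemented_subset_fm U (Var 0) (lift (lift a)) \<^bold>\<longrightarrow> Var 0 \<^bold>\<in> Var 1))))"

lemma hereditary_simps [simp]:
  "ren r (hereditary_fm U a) = hereditary_fm U (ren r a)"
  "sub \<sigma> (hereditary_fm U a) = hereditary_fm U (sub \<sigma> a)"
  "tyof (hereditary_fm U a) \<Gamma> = (if tyof a \<Gamma> = Some (Pow U) then Some Om else None)"
  by (auto simp: hereditary_fm_def)

lemma hereditary_D:
  assumes "\<Gamma> \<bar> \<Phi> \<turnstile> hereditary_fm U a" "\<Gamma> \<bar> \<Phi> \<turnstile> progressive_fm U X"
    and "\<Gamma> \<bar> \<Phi> \<turnstile> complemented_subset_fm U b a"
  shows "\<Gamma> \<bar> \<Phi> \<turnstile> (b \<^bold>\<in> X)"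
proof -
  have X: "tyof X \<Gamma> = Some (Pow (Pow U))"
    using entails_Om[OF assms(2)] by (simp split: if_splits)
  have b: "tyof b \<Gamma> = Some (Pow U)" using complemented_subset_typed[OF assms(3)] by simp
  have "\<Gamma> \<bar> \<Phi> \<turnstile> (\<^bold>\<forall>[Pow U] (complemented_subset_fm U (Var 0) (lift a) \<^bold>\<longrightarrow> Var 0 \<^bold>\<in> lift X))"
    using AllE_tyof[OF assms(1)[unfolded hereditary_fm_def] X] assms(2)
    by (simp add: inst_def ImpE)
  from AllE_tyof[OF this b] show ?thesis
    using assms(3) by (simp add: inst_def ImpE)
qed

lemma hereditary_I:
  assumes "tyof a \<Gamma> = Some (Pow U)" "wf_hyps \<Gamma> \<Phi>"
  defines "\<Psi> \<equiv> complemented_subset_fm U (Var 0) (lift (lift a)) #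
      progressive_fm U (Var 1) # map lift (map lift \<Phi>)"
  assumes "Pow U # Pow (Pow U) # \<Gamma> \<bar> \<Psi> \<turnstile> progressive_fm U (Var 1) \<Longrightarrow>
      Pow U # Pow (Pow U) # \<Gamma> \<bar> \<Psi> \<turnstile> complemented_subset_fm U (Var 0) (lift (lift a)) \<Longrightarrow>
      Pow U # Pow (Pow U) # \<Gamma> \<bar> \<Psi> \<turnstile> (Var 0 \<^bold>\<in> Var 1)"
  shows "\<Gamma> \<bar> \<Phi> \<turnstile> hereditary_fm U a"
proof -
  \<comment> \<open>\<open>map_map\<close> would fuse the two liftings, and the rule for
    \<open>wf_hyps\<close> on \<open>map lift\<close> would no longer match.\<close>
  have "wf_hyps (Pow U # Pow (Pow U) # \<Gamma>) \<Psi>" using assms(1,2) by (simp add: \<Psi>_def del: map_map)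
  then have "Pow U # Pow (Pow U) # \<Gamma> \<bar> \<Psi> \<turnstile> (Var 0 \<^bold>\<in> Var 1)"
    by (intro assms(4); intro entails_hyp) (simp_all add: \<Psi>_def)
  then show ?thesis unfolding hereditary_fm_def \<Psi>_def
    by (intro AllI ImpI) simp
qed

text \<open>A complemented subset of the empty set is empty. So the empty set has no proper one, and
  it belongs to every progressive family vacuously.\<close>

lemma hereditary_empty:
  assumes "wf_hyps \<Gamma> \<Phi>"
  shows "\<Gamma> \<bar> \<Phi> \<turnstile> hereditary_fm U (empty_tm U)"
proof -
  \<comment> \<open>Stated for arbitrary contexts, since it is applied below different numbers of
    binders.\<close>
  have eq_empty: "\<Gamma> \<bar> \<Phi> \<turnstile> (empty_tm U \<^bold>= b)"
    if b: "\<Gamma> \<bar> \<Phi> \<turnstile> complemented_subset_fm U b (empty_tm U)" for \<Gamma> \<Phi> b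
  proof (rule set_eqI)
    note wf = entails_wf[OF b] and ty = complemented_subset_typed[OF b]
    let ?b = "Var 0 \<^bold>\<in> lift b" and ?e = "Var 0 \<^bold>\<in> empty_tm U"
    have "U # \<Gamma> \<bar> ?b # map lift \<Phi> \<turnstile> complemented_subset_fm U (lift b) (empty_tm U)"
      using entails_lift_cons[OF b, of ?b U] by (simp add: ty)
    moreover have "U # \<Gamma> \<bar> ?b # map lift \<Phi> \<turnstile> ?b"
      by (rule entails_hyp) (simp_all add: wf ty)
    ultimately have "U # \<Gamma> \<bar> ?b # map lift \<Phi> \<turnstile> ?e" by (rule complemented_subset_D)
    then show "U # \<Gamma> \<bar> ?b # map lift \<Phi> \<turnstile> (Var 0 \<^bold>\<in> lift (empty_tm U))" by simp
    have "U # \<Gamma> \<bar> ?e # map lift \<Phi> \<turnstile> ?e"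
      by (rule entails_hyp) (simp_all add: wf)
    from BotE_tyof[OF mem_empty_D[OF this], of ?b]
    show "U # \<Gamma> \<bar> (Var 0 \<^bold>\<in> lift (empty_tm U)) # map lift \<Phi> \<turnstile> ?b"
      by (simp add: ty)
  qed
  have empty_mem: "\<Gamma> \<bar> \<Phi> \<turnstile> (empty_tm U \<^bold>\<in> X)"
    if X: "\<Gamma> \<bar> \<Phi> \<turnstile> progressive_fm U X" for \<Gamma> \<Phi> X
  proof (rule progressive_D[OF X])
    show "\<Gamma> \<bar> \<Phi> \<turnstile> (empty_tm U \<^bold>\<in> Fin_tm U)"
      by (rule Fin_empty[OF entails_wf[OF X]])
    have "tyof X \<Gamma> = Some (Pow (Pow U))"
      using entails_Om[OF X] by (simp split: if_splits)
    then have ty: "tyof (Var 0 \<^bold>\<in> lift X) (Pow U # \<Gamma>) = Some Om" by simp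
    let ?h = "complemented_proper_subset_fm U (Var 0) (lift (empty_tm U))"
    assume "Pow U # \<Gamma> \<bar> ?h # map lift \<Phi> \<turnstile> ?h"
    then have c: "Pow U # \<Gamma> \<bar> ?h # map lift \<Phi> \<turnstile> complemented_subset_fm U (Var 0) (empty_tm U)"
      and ne: "Pow U # \<Gamma> \<bar> ?h # map lift \<Phi> \<turnstile> \<^bold>\<not> (Var 0 \<^bold>= empty_tm U)"
      unfolding complemented_proper_subset_fm_def by (auto intro: AndE1 AndE2)
    show "Pow U # \<Gamma> \<bar> ?h # map lift \<Phi> \<turnstile> (Var 0 \<^bold>\<in> lift X)"
      by (rule BotE_tyof[OF ImpE[OF ne eq_sym[OF eq_empty[OF c]]] ty])
  qed
  show ?thesis
    by (rule hereditary_I) (use assms in \<open>auto intro: eq_mem_left[OF eq_empty empty_mem]\<close>)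
qed

text \<open>An implication, not a conjunction: sets not complemented in \<open>a\<close> belong
  vacuously, so progressiveness has to be checked only for those that are.\<close>

definition extension_tm :: "'g ty \<Rightarrow> 'g tm \<Rightarrow> 'g tm \<Rightarrow> 'g tm \<Rightarrow> 'g tm" where
  "extension_tm U a x X = \<^bold>{[Pow U] complemented_subset_fm U (Var 0) (lift a) \<^bold>\<longrightarrow>
     insert_tm U (Var 0) (lift x) \<^bold>\<in> lift X\<^bold>}"

lemma extension_simps [simp]:
  "ren r (extension_tm U a x X) = extension_tm U (ren r a) (ren r x) (ren r X)"
  "tyof (extension_tm U a x X) \<Gamma> = (if tyof a \<Gamma> = Some (Pow U) \<and> tyof x \<Gamma> = Some U \<and>
     tyof X \<Gamma> = Some (Pow (Pow U)) then Some (Pow (Pow U)) else None)"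
  by (auto simp: extension_tm_def)

lemma extension_D:
  assumes "\<Gamma> \<bar> \<Phi> \<turnstile> (b \<^bold>\<in> extension_tm U a x X)" "\<Gamma> \<bar> \<Phi> \<turnstile> complemented_subset_fm U b a"
  shows "\<Gamma> \<bar> \<Phi> \<turnstile> (insert_tm U b x \<^bold>\<in> X)"
  using ComprE[OF assms(1)[unfolded extension_tm_def]] assms(2) by (simp add: inst_def ImpE)

text \<open>If \<open>x \<in> c\<close>, the induction hypothesis for \<open>c \<inter> b\<close>
  gives \<open>(c \<inter> b) \<union> {x} \<in> X\<close>, and this set is \<open>c\<close>. If
  not, \<open>c\<close> is complemented in \<open>b\<close>, hence in \<open>a\<close>, and heredity
  of \<open>a\<close> applies to \<open>X\<close> itself.\<close>

lemma extension_proper_subset: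
  assumes IH: "\<Gamma> \<bar> \<Phi> \<turnstile> proper_subsets_in_fm U b (extension_tm U a x X)"
    and a: "\<Gamma> \<bar> \<Phi> \<turnstile> hereditary_fm U a" and X: "\<Gamma> \<bar> \<Phi> \<turnstile> progressive_fm U X"
    and ba: "\<Gamma> \<bar> \<Phi> \<turnstile> complemented_subset_fm U b a"
    and cb: "\<Gamma> \<bar> \<Phi> \<turnstile> complemented_proper_subset_fm U c (insert_tm U b x)"
  shows "\<Gamma> \<bar> \<Phi> \<turnstile> (c \<^bold>\<in> X)"
proof -
  note cb' = AndE1[OF cb[unfolded complemented_proper_subset_fm_def]]
  note ty = complemented_subset_insert_typed[OF cb']
  show ?thesis
  proof (rule OrE_hyp[OF complemented_subset_insert_dec[OF cb']])
    let ?x = "x \<^bold>\<in> c"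
    have tx: "tyof ?x \<Gamma> = Some Om" by (simp add: ty)
    note w = entails_cons[OF _ tx]
    assume x: "\<Gamma> \<bar> ?x # \<Phi> \<turnstile> ?x"
    note p = complemented_proper_subset_inter[OF w[OF cb] x]
    have "\<Gamma> \<bar> ?x # \<Phi> \<turnstile> complemented_subset_fm U (inter_tm U c b) a"
      by (rule complemented_subset_trans[OF complemented_subset_inter[OF w[OF cb']] w[OF ba]])
    with proper_subsets_in_D[OF w[OF IH] p]
    have "\<Gamma> \<bar> ?x # \<Phi> \<turnstile> (insert_tm U (inter_tm U c b) x \<^bold>\<in> X)" by (rule extension_D)
    with insert_inter_eq[OF w[OF cb'] x] show "\<Gamma> \<bar> ?x # \<Phi> \<turnstile> (c \<^bold>\<in> X)"
      by (rule eq_mem_left)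
  next
    let ?x = "\<^bold>\<not> (x \<^bold>\<in> c)"
    have tx: "tyof ?x \<Gamma> = Some Om" by (simp add: ty)
    note w = entails_cons[OF _ tx]
    assume x: "\<Gamma> \<bar> ?x # \<Phi> \<turnstile> ?x"
    show "\<Gamma> \<bar> ?x # \<Phi> \<turnstile> (c \<^bold>\<in> X)"
      by (rule hereditary_D[OF w[OF a] w[OF X] complemented_subset_trans[OF
            complemented_subset_of_insert[OF w[OF cb'] x] w[OF ba]]])
  qed
qed

text \<open>For \<open>b\<close> finite and complemented in \<open>a\<close>, the goal
  \<open>b \<union> {x} \<in> X\<close> follows from progressiveness of \<open>X\<close> at
  \<open>b \<union> {x}\<close>; its proper complemented subsets are handled by
  \<open>extension_proper_subset\<close>.\<close>

lemma extension_progressive: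
  assumes a: "\<Gamma> \<bar> \<Phi> \<turnstile> hereditary_fm U a" and X: "\<Gamma> \<bar> \<Phi> \<turnstile> progressive_fm U X"
    and x: "tyof x \<Gamma> = Some U"
  shows "\<Gamma> \<bar> \<Phi> \<turnstile> progressive_fm U (extension_tm U a x X)"
proof -
  have ty: "tyof a \<Gamma> = Some (Pow U)" "tyof X \<Gamma> = Some (Pow (Pow U))"
    using entails_Om[OF a] entails_Om[OF X] by (auto split: if_splits)
  note wf = entails_wf[OF a]
  let ?E = "extension_tm U (lift a) (lift x) (lift X)"
  let ?G = "Pow U # \<Gamma>"
  \<comment> \<open>The two premises of progressiveness, preceded by the premise of the implication
    that defines the extension family.\<close>
  define \<Psi> where "\<Psi> = complemented_subset_fm U (Var 0) (lift a) #
    proper_subsets_in_fm U (Var 0) ?E # (Var 0 \<^bold>\<in> Fin_tm U) # map lift \<Phi>"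
  have wf': "wf_hyps ?G \<Psi>" by (simp add: \<Psi>_def wf ty x)
  have b: "?G \<bar> \<Psi> \<turnstile> complemented_subset_fm U (Var 0) (lift a)"
    and IH: "?G \<bar> \<Psi> \<turnstile> proper_subsets_in_fm U (Var 0) ?E"
    and fin: "?G \<bar> \<Psi> \<turnstile> (Var 0 \<^bold>\<in> Fin_tm U)"
    using wf' by (auto intro!: entails_hyp simp: \<Psi>_def)
  have a': "?G \<bar> \<Psi> \<turnstile> hereditary_fm U (lift a)" and X': "?G \<bar> \<Psi> \<turnstile> progressive_fm U (lift X)"
    using entails_weaken[OF entails_lift[OF a] _ wf'] entails_weaken[OF entails_lift[OF X] _ wf']
    by (auto simp: \<Psi>_def)
  have "?G \<bar> \<Psi> \<turnstile> (insert_tm U (Var 0) (lift x) \<^bold>\<in> lift X)"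
  proof (rule progressive_D[OF X' Fin_insert[OF fin]])
    let ?h = "complemented_proper_subset_fm U (Var 0) (lift (insert_tm U (Var 0) (lift x)))"
    have h: "tyof ?h (Pow U # ?G) = Some Om" by (simp add: x)
    note w = entails_lift_cons[OF _ h]
    assume "Pow U # ?G \<bar> ?h # map lift \<Psi> \<turnstile> ?h"
    then have "Pow U # ?G \<bar> ?h # map lift \<Psi> \<turnstile>
        complemented_proper_subset_fm U (Var 0) (insert_tm U (Var 1) (lift (lift x)))" by simp
    from extension_proper_subset[OF _ _ _ _ this] w[OF IH] w[OF a'] w[OF X'] w[OF b]
    show "Pow U # ?G \<bar> ?h # map lift \<Psi> \<turnstile> (Var 0 \<^bold>\<in> lift (lift X))" by simp
  qed (simp add: x)
  then have "?G \<bar> proper_subsets_in_fm U (Var 0) ?E # (Var 0 \<^bold>\<in> Fin_tm U) # map lift \<Phi> \<turnstile>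
      (Var 0 \<^bold>\<in> ?E)"
    unfolding \<Psi>_def extension_tm_def by (subst compr_iff) (auto simp: inst_def ty x intro: ImpI)
  then show ?thesis
    unfolding progressive_fm_eq by (intro AllI ImpI) simp
qed

lemma hereditary_insert:
  assumes a: "\<Gamma> \<bar> \<Phi> \<turnstile> hereditary_fm U a" and x: "tyof x \<Gamma> = Some U"
  shows "\<Gamma> \<bar> \<Phi> \<turnstile> hereditary_fm U (insert_tm U a x)"
proof (rule hereditary_I)
  have ty: "tyof a \<Gamma> = Some (Pow U)" using entails_Om[OF a] by (simp split: if_splits)
  show "tyof (insert_tm U a x) \<Gamma> = Some (Pow U)" by (simp add: ty x)
  show "wf_hyps \<Gamma> \<Phi>" using a by (rule entails_wf)
  \<comment> \<open>The argument for one family and one subset; the context is arbitrary because it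
    is used below the two quantifiers of \<open>hereditary_fm\<close>.\<close>
  have step: "\<Gamma> \<bar> \<Phi> \<turnstile> (b \<^bold>\<in> X)"
    if a: "\<Gamma> \<bar> \<Phi> \<turnstile> hereditary_fm U a" and X: "\<Gamma> \<bar> \<Phi> \<turnstile> progressive_fm U X"
      and b: "\<Gamma> \<bar> \<Phi> \<turnstile> complemented_subset_fm U b (insert_tm U a x)" for \<Gamma> \<Phi> a x b X
  proof (rule OrE_hyp[OF complemented_subset_insert_dec[OF b]])
    note ty = complemented_subset_insert_typed[OF b]
    let ?x = "x \<^bold>\<in> b"
    have tx: "tyof ?x \<Gamma> = Some Om" by (simp add: ty)
    note w = entails_cons[OF _ tx]
    assume x: "\<Gamma> \<bar> ?x # \<Phi> \<turnstile> ?x"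
    note i = complemented_subset_inter[OF w[OF b]]
    \<comment> \<open>Here heredity of \<open>a\<close> is applied to the extension family; in the
      other case below it is applied to \<open>X\<close>.\<close>
    have "\<Gamma> \<bar> ?x # \<Phi> \<turnstile> (inter_tm U b a \<^bold>\<in> extension_tm U a x X)"
      by (rule hereditary_D[OF w[OF a] extension_progressive[OF w[OF a] w[OF X]] i]) (rule ty)
    then have "\<Gamma> \<bar> ?x # \<Phi> \<turnstile> (insert_tm U (inter_tm U b a) x \<^bold>\<in> X)"
      using i by (rule extension_D)
    with insert_inter_eq[OF w[OF b] x] show "\<Gamma> \<bar> ?x # \<Phi> \<turnstile> (b \<^bold>\<in> X)"
      by (rule eq_mem_left)
  next
    note ty = complemented_subset_insert_typed[OF b]
    let ?x = "\<^bold>\<not> (x \<^bold>\<in> b)"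
    have tx: "tyof ?x \<Gamma> = Some Om" by (simp add: ty)
    note w = entails_cons[OF _ tx]
    assume x: "\<Gamma> \<bar> ?x # \<Phi> \<turnstile> ?x"
    show "\<Gamma> \<bar> ?x # \<Phi> \<turnstile> (b \<^bold>\<in> X)"
      by (rule hereditary_D[OF w[OF a] w[OF X] complemented_subset_of_insert[OF w[OF b] x]])
  qed
  let ?G = "Pow U # Pow (Pow U) # \<Gamma>"
  let ?P = "complemented_subset_fm U (Var 0) (lift (lift (insert_tm U a x))) #
      progressive_fm U (Var 1) # map lift (map lift \<Phi>)"
  assume X: "?G \<bar> ?P \<turnstile> progressive_fm U (Var 1)"
    and b: "?G \<bar> ?P \<turnstile> complemented_subset_fm U (Var 0) (lift (lift (insert_tm U a x)))"
  have "?G \<bar> ?P \<turnstile> hereditary_fm U (lift (lift a))"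
    using entails_weaken[OF entails_lift[OF entails_lift[OF a]] _ entails_wf[OF X]] by auto
  then show "?G \<bar> ?P \<turnstile> (Var 0 \<^bold>\<in> Var 1)"
    using X b by (intro step[of _ _ "lift (lift a)" _ _ "lift (lift x)"]) simp_all
qed

lemma Fin_hereditary:
  assumes a: "\<Gamma> \<bar> \<Phi> \<turnstile> (a \<^bold>\<in> Fin_tm U)"
  shows "\<Gamma> \<bar> \<Phi> \<turnstile> hereditary_fm U a"
proof -
  \<comment> \<open>Comprehension is impredicative, so the hereditary sets form a family to which
    \<open>Fin_D\<close> applies. \<open>F\<close> is a closed term, which is why renaming leaves it
    fixed.\<close>
  define F where "F = \<^bold>{[Pow U] hereditary_fm U (Var 0)\<^bold>}"
  have mem_F: "(\<Gamma> \<bar> \<Phi> \<turnstile> (b \<^bold>\<in> F)) = (\<Gamma> \<bar> \<Phi> \<turnstile> hereditary_fm U b)"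
    if "tyof b \<Gamma> = Some (Pow U)" for \<Gamma> \<Phi> b
    unfolding F_def using that by (subst compr_iff) (simp_all add: inst_def)
  have [simp]: "ren r F = F" for r by (simp add: F_def)
  have [simp]: "tyof F \<Gamma> = Some (Pow (Pow U))" for \<Gamma> by (simp add: F_def)
  note wf = entails_wf[OF a]
  have "\<Gamma> \<bar> \<Phi> \<turnstile> Fin_closed_fm U F"
    unfolding Fin_closed_fm_def
  proof (intro AndI AllI ImpI_hyp)
    show "\<Gamma> \<bar> \<Phi> \<turnstile> (empty_tm U \<^bold>\<in> F)"
      by (subst mem_F) (simp_all add: hereditary_empty wf)
    let ?G = "U # Pow U # \<Gamma>" and ?P = "(Var 1 \<^bold>\<in> lift (lift F)) # map lift (map lift \<Phi>)"
    assume "?G \<bar> ?P \<turnstile> (Var 1 \<^bold>\<in> lift (lift F))"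
    then have "?G \<bar> ?P \<turnstile> hereditary_fm U (Var 1)" by (simp add: mem_F)
    then show "?G \<bar> ?P \<turnstile> (insert_tm U (Var 1) (Var 0) \<^bold>\<in> lift (lift F))"
      by (simp add: mem_F hereditary_insert)
  qed (simp_all add: wf del: map_map)
  from Fin_D[OF a this] show ?thesis
    using mem_F mem_typedD[OF a] by simp
qed

theorem theorem1:
  fixes U :: "'g ty"
  shows "[] \<bar> [] \<turnstile>
    (\<^bold>\<forall>[Pow (Pow U)]
       (subset_fm (Pow U) (Var 0) (Fin_tm U) \<^bold>\<and> progressive_fm U (Var 0) \<^bold>\<longrightarrow>
        (\<^bold>\<forall>[Pow U] (Var 0 \<^bold>\<in> Fin_tm U \<^bold>\<longrightarrow> Var 0 \<^bold>\<in> Var 1))))"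
proof (intro AllI ImpI)
  \<comment> \<open>The context left by the two quantifiers: index 0 is the finite set, index 1 the
    family.\<close>
  let ?G = "[Pow U, Pow (Pow U)]"
  let ?P = "(Var 0 \<^bold>\<in> Fin_tm U) #
    map lift ((subset_fm (Pow U) (Var 0) (Fin_tm U) \<^bold>\<and> progressive_fm U (Var 0)) # map lift [])"
  have wf: "wf_hyps ?G ?P" by simp
  have "?G \<bar> ?P \<turnstile> (subset_fm (Pow U) (Var 1) (Fin_tm U) \<^bold>\<and> progressive_fm U (Var 1))"
    using wf by (rule entails_hyp) simp
  then have X: "?G \<bar> ?P \<turnstile> progressive_fm U (Var 1)" by (rule AndE2)
  have "?G \<bar> ?P \<turnstile> (Var 0 \<^bold>\<in> Fin_tm U)"
    using wf by (rule entails_hyp) simp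
  then have "?G \<bar> ?P \<turnstile> hereditary_fm U (Var 0)" by (rule Fin_hereditary)
  \<comment> \<open>Heredity is used for the given family and for the set as a complemented subset
    of itself.\<close>
  then show "?G \<bar> ?P \<turnstile> (Var 0 \<^bold>\<in> Var 1)"
    using X by (rule hereditary_D) (rule complemented_subset_refl[OF _ wf], simp)
qed

end
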